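(* Let $\mathbb{S}=\mathbb{R}/2\pi\mathbb{Z}$ and for a positive integer $q$ and $t\in\mathbb{S}$ let $$U_q(t)=\bigl(\cos t,\ \sin t,\ \cos 3t,\ \sin 3t,\ \ldots,\ \cos(2q-1)t,\ \sin(2q-1)t\bigr)\in\mathbb{R}^{2q}.$$ Fix an integer $k\ge 1$. For a non-negative integer $m$ define $\Psi_{k,m}:\mathbb{S}\to\mathbb{R}^{6k(m+1)}$ by $$\Psi_{k,m}(t)=\bigl(U_{3k}(t),\ U_{3k}(5t),\ \ldots,\ U_{3k}(5^m t)\bigr).$$ For a positive even integer $n$, let $$A_{m,n}=\left\{\frac{2\pi j}{n5^m}:\ j=0,\ldots,n5^m-1\right\}\subset\mathbb{S}$$ and let $P=P_{k,m,n}=\operatorname{conv}\bigl(\Psi_{k,m}(t):\ t\in A_{m,n}\bigr)$. Then: (1) $P\subset\mathbb{R}^{6k(m+1)}$ is a centrally symmetric polytope (i.e. $P=-P$) with $n5^m$ distinct vertices, namely $\Psi_{k,m}(t)$ for $t\in A_{m,n}$, and its dimension satisfies $\dim P\le 6k(m+1)-2m\lfloor(3k+2)/5\rfloor$; moreover, if $n>2(6k-1)$, then $\dim P=6k(m+1)-2m\lfloor(3k+2)/5\rfloor$. (2) Let $t_1,\ldots,t_k$ be points chosen independently at random from the uniform distribution on $A_{m,n}$ (some of them may coincide). Then the probability that $\operatorname{conv}\bigl(\Psi_{k,m}(t_1),\ldots,\Psi_{k,m}(t_k)\bigr)$ is not a face of $P$ is at most $\left(1-5^{-k+1}\right)^m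$.
   Context: A polytope is the convex hull of finitely many points in $\mathbb{R}^d$. A face of a convex body is its intersection with a supporting affine hyperplane. The dimension of a polytope is the dimension of its affine hull. *)

theory Defs
  imports "HOL-Analysis.Analysis"
begin

definition U :: "nat \<Rightarrow> real \<Rightarrow> nat \<Rightarrow> real" where
  "U q s r = (if r < 2 * q then
      (if even r then cos (real (2 * (r div 2) + 1) * s)
       else sin (real (2 * (r div 2) + 1) * s))
    else 0)"

definition Psi :: "nat \<Rightarrow> nat \<Rightarrow> real \<Rightarrow> nat \<Rightarrow> real" where
  "Psi k m t i = (if i < 6 * k * (m + 1)
      then U (3 * k) (5 ^ (i div (6 * k)) * t) (i mod (6 * k)) else 0)"

text \<open>Psi_{k,m}(t) as a vector of R^{6k(m+1)}, realised as real^'n where the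
  coordinates of 'n are identified with {0..<6k(m+1)} via the bijection beta.\<close>
definition PsiVec :: "nat \<Rightarrow> nat \<Rightarrow> ('n::finite \<Rightarrow> nat) \<Rightarrow> real \<Rightarrow> real ^ 'n" where
  "PsiVec k m beta t = (\<chi> i. Psi k m t (beta i))"

definition A :: "nat \<Rightarrow> nat \<Rightarrow> real set" where
  "A m n = {2 * pi * real j / (real n * 5 ^ m) | j. j < n * 5 ^ m}"

definition Ptope :: "nat \<Rightarrow> nat \<Rightarrow> nat \<Rightarrow> ('n::finite \<Rightarrow> nat) \<Rightarrow> (real ^ 'n) set" where
  "Ptope k m n beta = convex hull (PsiVec k m beta ` A m n)"

end

theory Submission
  imports Defs "HOL-Computational_Algebra.Polynomial" "HOL-Number_Theory.Cong"
begin

text \<open>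
  Up to the identification of the vertex parameters with residues modulo \<open>N = n 5\<^sup>m\<close>, a trigonometric
  polynomial \<open>f\<close> with odd frequencies at most \<open>6k - 1\<close>, evaluated at \<open>5\<^sup>i t\<close>, is a linear functional on
  the vertices. If the points \<open>5\<^sup>i t\<^sub>1, \<dots>, 5\<^sup>i t\<^sub>k\<close> lie in an arc of length \<open>2\<pi>/5\<close>, there is such an
  \<open>f \<le> 1\<close> whose maximum is attained only at these points and their reflections in the centre of the
  arc. The vertices with \<open>f = 1\<close> span a face. On this face \<open>5\<^sup>i t\<close> takes at most \<open>2k\<close> values, no two of
  them antipodal, and \<open>6k\<close> such values can be interpolated arbitrarily; this cuts out the face of all
  \<open>t\<close> with \<open>5\<^sup>i t \<in> {5\<^sup>i t\<^sub>1, \<dots>, 5\<^sup>i t\<^sub>k}\<close>. Now one descends: given the same for \<open>5\<^sup>l\<^sup>+\<^sup>1\<close>, the points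
  \<open>5\<^sup>l t\<close> take at most \<open>5k\<close> values, and interpolation cuts down to exponent \<open>l\<close>; exponent \<open>0\<close> is
  the claim. Which of five arcs contains \<open>5\<^sup>i t\<close> is a base-5 digit of the index of \<open>t\<close>, so for
  \<open>m\<close> independent digits, \<open>k\<close> random indices agree in none of them with probability
  \<open>(1 - 5\<^sup>1\<^sup>-\<^sup>k)\<^sup>m\<close>. The dimension is twice the number of distinct frequencies \<open>5\<^sup>i (2r + 1)\<close>, by
  discrete orthogonality of the harmonics.
\<close>

section \<open>Peaking odd polynomials\<close>

text \<open>Rolle's theorem on each gap, adding the points in increasing order. That
  \<open>R\<close> avoids \<open>C\<close> and stays in the open interval lets its zeros be counted
  alongside further zeros at points of \<open>C\<close>.\<close>

lemma Rolle_card: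
  fixes f f' :: "real \<Rightarrow> real"
  assumes "finite C" and "C \<noteq> {}"
    and der: "\<And>x. (f has_real_derivative f' x) (at x)"
    and "\<And>x. x \<in> C \<Longrightarrow> f x = a"
  shows "\<exists>R. finite R \<and> card R + 1 = card C \<and> R \<inter> C = {} \<and>
    R \<subseteq> {Min C<..<Max C} \<and> (\<forall>x\<in>R. f' x = 0)"
  using assms(1,2,4)
proof (induction C rule: finite_linorder_max_induct)
  case empty
  then show ?case by simp
next
  case (insert b C)
  show ?case
  proof (cases "C = {}")
    case True
    then show ?thesis by (intro exI[of _ "{}"]) auto
  next
    case False
    then obtain R where R: "finite R" "card R + 1 = card C" "R \<inter> C = {}"
      "R \<subseteq> {Min C<..<Max C}" "\<forall>x\<in>R. f' x = 0"
      using insert by (metis insertCI)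
    have "Max C \<in> C" using False insert.hyps(1) by simp
    then have lt: "Max C < b" and eq: "f (Max C) = f b"
      using insert by auto
    obtain z where z: "Max C < z" "z < b" "f b - f (Max C) = (b - Max C) * f' z"
      using MVT2[OF lt der] by blast
    have z0: "f' z = 0" using z lt eq by simp
    have "Min C \<in> C" using False insert.hyps(1) by simp
    then have "Min C < b" using insert.hyps(2) by blast
    then have mm: "Min (insert b C) = Min C" "Max (insert b C) = b"
      using False insert.hyps(1) lt by (simp_all del: Min_less_iff Max_less_iff)
    have "z \<notin> R" "z \<notin> C" using R(4) z insert.hyps(1) by (auto dest: Max_ge)
    have "R \<inter> insert b C = {}" using R(3,4) lt by auto
    have "Min C \<le> Max C" using False insert.hyps(1) by simp
    show ?thesis
      using R z z0 mm \<open>z \<notin> R\<close> \<open>z \<notin> C\<close> \<open>R \<inter> insert b C = {}\<close> insert.hyps lt \<open>Min C \<le> Max C\<close>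
      by (intro exI[of _ "insert z R"]) (auto simp: order.strict_trans)
  qed
qed

text \<open>Subtracting the multiple of the product cancels the coefficient at
  \<open>card X\<close>, leaving degree below \<open>card X\<close> but all of \<open>X\<close> as
  roots. If \<open>p\<close> has smaller degree, the factor is \<open>0\<close>.\<close>

lemma poly_eq_prod_of_roots:
  fixes p :: "'a::idom poly"
  assumes "finite X" and "degree p \<le> card X" and "\<And>x. x \<in> X \<Longrightarrow> poly p x = 0"
  shows "p = smult (coeff p (card X)) (\<Prod>x\<in>X. [:-x, 1:])"
proof (rule ccontr)
  let ?M = "\<Prod>x\<in>X. [:-x, 1:]" and ?L = "coeff p (card X)"
  let ?q = "p - smult ?L ?M"
  assume "p \<noteq> smult ?L ?M"
  then have q0: "?q \<noteq> 0" by simp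
  have dM: "degree ?M = card X"
    by (subst degree_prod_sum_eq) auto
  have lM: "coeff ?M (card X) = 1"
    using dM lead_coeff_prod[of "\<lambda>x. [:-x, 1:]" X] by simp
  have dq: "degree ?q \<le> card X"
    by (rule degree_diff_le) (use assms(2) dM in \<open>auto intro: order.trans[OF degree_smult_le]\<close>)
  have "coeff ?q (card X) = 0" using lM by simp
  then have lt: "degree ?q < card X"
    using dq q0 by (metis leading_coeff_0_iff le_neq_implies_less)
  have "X \<subseteq> {x. poly ?q x = 0}"
    using assms(1,3) by (auto simp: poly_prod)
  then have "card X \<le> card {x. poly ?q x = 0}"
    using poly_roots_finite[OF q0] card_mono by blast
  also have "\<dots> \<le> degree ?q" by (rule card_poly_roots_bound[OF q0])
  finally show False using lt by simp
qed

text \<open>Newton-style induction: a multiple of \<open>w * w\<close> leaves values and derivatives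
  at the old nodes alone, so a linear cofactor is free to meet the two conditions at the new
  node.\<close>

lemma Hermite_interpolation:
  fixes a b :: "real \<Rightarrow> real"
  assumes "finite X"
  shows "\<exists>r. degree r \<le> 2 * card X - 1 \<and>
    (\<forall>x\<in>X. poly r x = a x \<and> poly (pderiv r) x = b x)"
  using assms
proof (induction X)
  case empty
  show ?case by (intro exI[of _ 0]) simp
next
  case (insert z X)
  then obtain r where r: "degree r \<le> 2 * card X - 1"
    "\<forall>x\<in>X. poly r x = a x \<and> poly (pderiv r) x = b x" by blast
  define w where "w = (\<Prod>x\<in>X. [:-x, 1:])"
  have w0: "poly w z \<noteq> 0" and wX: "\<And>x. x \<in> X \<Longrightarrow> poly w x = 0"
    using insert.hyps by (auto simp: w_def poly_prod)
  have dw: "degree w = card X"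
    unfolding w_def by (subst degree_prod_sum_eq) auto
  \<comment> \<open>The cofactor in \<open>s\<close> is \<open>al + be * (x - z)\<close>:
    \<open>al\<close> corrects the value at \<open>z\<close>, then \<open>be\<close> the
    derivative.\<close>
  define al where "al = (a z - poly r z) / (poly w z)^2"
  define be where "be = (b z - poly (pderiv r) z - 2 * poly w z * poly (pderiv w) z * al) / (poly w z)^2"
  define s where "s = r + w * w * [:al - be * z, be:]"
  have "degree (w * w * [:al - be * z, be:]) \<le> card X + card X + 1"
    using degree_mult_le[of "w * w" "[:al - be * z, be:]"] degree_mult_le[of w w] dw
      degree_pCons_le[of "al - be * z" "[:be:]"] by simp
  then have "degree s \<le> 2 * card (insert z X) - 1"
    unfolding s_def using r(1) insert.hyps by (intro degree_add_le) auto
  moreover have "poly s x = a x \<and> poly (pderiv s) x = b x" if "x \<in> insert z X" for x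
  proof (cases "x = z")
    case True
    have "poly s z = poly r z + (poly w z)^2 * al"
      by (simp add: s_def power2_eq_square algebra_simps)
    then have "poly s z = a z"
      using w0 by (simp add: al_def)
    moreover have "poly (pderiv s) z = poly (pderiv r) z + (2 * poly w z * poly (pderiv w) z * al + (poly w z)^2 * be)"
      by (simp add: s_def pderiv_add pderiv_mult pderiv_smult pderiv_pCons algebra_simps power2_eq_square)
    moreover have "(poly w z)^2 * be = b z - poly (pderiv r) z - 2 * poly w z * poly (pderiv w) z * al"
      using w0 by (simp add: be_def)
    ultimately show ?thesis using True by simp
  next
    case False
    then have "x \<in> X" using that by simp
    then show ?thesis using r(2) wX
      by (simp add: s_def pderiv_add pderiv_mult pderiv_smult pderiv_pCons)
  qed
  ultimately show ?case by blast
qed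

text \<open>Storing an odd polynomial through \<open>r\<close> makes its derivative a polynomial in
  \<open>c ^ 2\<close>, so zeros are counted in that variable at half the degree.\<close>

definition odd_fun :: "real poly \<Rightarrow> real \<Rightarrow> real" where
  "odd_fun r c = c * poly r (c^2)"

definition odd_deriv :: "real poly \<Rightarrow> real poly" where
  "odd_deriv r = r + smult 2 (pCons 0 (pderiv r))"

lemma coeff_odd_deriv: "coeff (odd_deriv r) i = (1 + 2 * real i) * coeff r i"
  by (cases i) (auto simp: odd_deriv_def coeff_pderiv algebra_simps)

lemma odd_fun_has_derivative:
  "(odd_fun r has_real_derivative poly (odd_deriv r) (c^2)) (at c)"
proof -
  have "((\<lambda>c. c * poly r (c^2)) has_real_derivative
      poly r (c^2) + c * (poly (pderiv r) (c^2) * (2 * c))) (at c)"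
    by (auto intro!: derivative_eq_intros DERIV_chain'[where g = "poly r"] poly_DERIV)
  moreover have "poly r (c^2) + c * (poly (pderiv r) (c^2) * (2 * c)) = poly (odd_deriv r) (c^2)"
    by (simp add: odd_deriv_def power2_eq_square algebra_simps)
  ultimately show ?thesis by (simp add: odd_fun_def[abs_def])
qed

lemma continuous_odd_fun: "continuous_on S (odd_fun r)"
  by (auto simp: odd_fun_def[abs_def] intro!: continuous_intros)

text \<open>The derivative of \<open>odd_fun r\<close> is a polynomial in \<open>c\<^sup>2\<close>; the double nodes and Rolle's points between
  the nodes account for all its zeros, so it has no zero below the first node.\<close>

lemma odd_fun_below_nodes:
  assumes "finite C" "C \<noteq> {}" "\<And>c. c \<in> C \<Longrightarrow> 0 < c"
    and val: "\<And>c. c \<in> C \<Longrightarrow> odd_fun r c = 1"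
    and K: "K \<subseteq> C" "\<And>c. c \<in> K \<Longrightarrow> poly (odd_deriv r) (c^2) = 0"
    and deg: "degree r \<le> card C + card K - 1"
  shows "y \<in> {0<..<Min C} \<Longrightarrow> 0 < odd_fun r y \<and> odd_fun r y < 1"
    and "even (card C + card K - 1) \<Longrightarrow> 0 < coeff r (card C + card K - 1)"
proof -
  define d where "d = card C + card K - 1"
  obtain R where R: "finite R" "card R + 1 = card C" "R \<inter> C = {}"
      "R \<subseteq> {Min C<..<Max C}" "\<forall>x\<in>R. poly (odd_deriv r) (x^2) = 0"
    using Rolle_card[OF assms(1,2) odd_fun_has_derivative val] by blast
  have mC: "Min C \<in> C" "0 < Min C" using assms(1-3) by auto
  \<comment> \<open>Squaring is injective on positive points, so \<open>X\<close> has
    \<open>d\<close> elements, as many as the degree bound for the derivative in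
    \<open>c ^ 2\<close>; the derivative is then a constant times the product over
    \<open>X\<close>.\<close>
  define X where "X = (\<lambda>c. c^2) ` (R \<union> K)"
  have fin: "finite K" "finite X" using K(1) assms(1) R(1) finite_subset X_def by auto
  have RK: "\<And>c. c \<in> R \<union> K \<Longrightarrow> Min C \<le> c" using R(4) K(1) assms(1) by auto
  have "inj_on (\<lambda>c::real. c^2) (R \<union> K)"
    using RK mC by (intro inj_onI) (smt (verit) power2_eq_iff_nonneg)
  then have "card X = card (R \<union> K)" unfolding X_def by (rule card_image)
  also have "\<dots> = card R + card K"
    using R(1,3) K(1) fin by (intro card_Un_disjoint) auto
  finally have cX: "card X = d" using R(2) d_def by simp
  define L where "L = coeff (odd_deriv r) d"
  have "degree (odd_deriv r) \<le> d"
    using deg by (intro degree_le) (auto simp: coeff_odd_deriv d_def coeff_eq_0)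
  then have fact: "odd_deriv r = smult L (\<Prod>x\<in>X. [:-x, 1:])"
    using poly_eq_prod_of_roots[of X "odd_deriv r"] fin(2) cX R(5) K(2)
    by (auto simp: L_def X_def)
  have fact': "poly (odd_deriv r) u = L * (\<Prod>x\<in>X. u - x)" for u
    by (subst fact) (simp add: poly_prod)
  have z: "odd_fun r 0 = 0" by (simp add: odd_fun_def)
  \<comment> \<open>Rising from \<open>0\<close> at the origin to \<open>1\<close> at the first node
    forces a positive derivative at some \<open>xi\<close>; this makes \<open>L\<close> nonzero and
    later fixes its sign.\<close>
  obtain xi where xi: "0 < xi" "xi < Min C" "odd_fun r (Min C) - odd_fun r 0 = (Min C - 0) * poly (odd_deriv r) (xi^2)"
    using MVT2[OF mC(2) odd_fun_has_derivative] by blast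
  have xiL: "0 < L * (\<Prod>x\<in>X. xi^2 - x)"
    using xi(3) mC val[OF mC(1)] z fact' by (metis diff_zero zero_less_mult_pos zero_less_one)
  have Xlow: "u^2 < x" if x: "x \<in> X" and u: "0 \<le> u" "u < Min C" for u x
  proof -
    obtain c where c: "c \<in> R \<union> K" "x = c^2" using x unfolding X_def by blast
    then have "u < c" using RK u(2) by fastforce
    then show ?thesis using c u by (auto intro: power_strict_mono)
  qed
  have nz: "poly (odd_deriv r) (u^2) \<noteq> 0" if "0 \<le> u" "u < Min C" for u
  proof -
    have "L \<noteq> 0" using xiL by auto
    moreover have "(\<Prod>x\<in>X. u^2 - x) \<noteq> 0"
      using Xlow[OF _ that] fin(2) by fastforce
    ultimately show ?thesis by (simp add: fact')
  qed
  \<comment> \<open>A repeated value would give a zero of the derivative below \<open>Min C\<close>.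
    Hence neither \<open>0\<close> nor \<open>1\<close> is taken a second time, and by continuity
    the values in between stay strictly inside.\<close>
  have noRolle: "odd_fun r u \<noteq> odd_fun r v" if uv: "0 \<le> u" "u < v" "v \<le> Min C" for u v
  proof
    assume eq: "odd_fun r u = odd_fun r v"
    obtain z where "u < z" "z < v" "odd_fun r v - odd_fun r u = (v - u) * poly (odd_deriv r) (z^2)"
      using MVT2[OF uv(2) odd_fun_has_derivative] by blast
    then show False using nz[of z] uv eq by auto
  qed
  show "0 < odd_fun r y \<and> odd_fun r y < 1" if y: "y \<in> {0<..<Min C}"
  proof (rule conjI; rule ccontr)
    assume "\<not> 0 < odd_fun r y"
    then obtain u where "y \<le> u" "u \<le> Min C" "odd_fun r u = 0"
      using IVT'[of "odd_fun r" y 0 "Min C"] y val[OF mC(1)] continuous_odd_fun by auto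
    then show False using noRolle[of 0 u] y z by auto
  next
    assume "\<not> odd_fun r y < 1"
    then obtain u where "0 \<le> u" "u \<le> y" "odd_fun r u = 1"
      using IVT'[of "odd_fun r" 0 1 y] y z continuous_odd_fun by auto
    then show False using noRolle[of u "Min C"] y val[OF mC(1)] by auto
  qed
  \<comment> \<open>Every factor \<open>xi ^ 2 - x\<close> is negative; an even number of them has a
    positive product, so \<open>L\<close> takes the sign of the derivative at
    \<open>xi\<close>.\<close>
  assume ev: "even (card C + card K - 1)"
  have "(\<Prod>x\<in>X. xi^2 - x) = (\<Prod>x\<in>X. - 1 * (x - xi^2))" by simp
  also have "\<dots> = (\<Prod>x\<in>X. -1) * (\<Prod>x\<in>X. x - xi^2)" by (rule prod.distrib)
  also have "\<dots> = (\<Prod>x\<in>X. x - xi^2)" using ev cX d_def by simp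
  also have "\<dots> > 0" using Xlow[of _ xi] xi by (intro prod_pos) auto
  finally have "0 < L" using xiL by (simp add: zero_less_mult_iff)
  then show "0 < coeff r (card C + card K - 1)"
    unfolding d_def[symmetric] by (simp add: L_def coeff_odd_deriv zero_less_mult_iff)
qed

text \<open>Interpolate \<open>1\<close> doubly at the nodes. To bound the interpolant at another point \<open>c\<close> add the multiple
  \<open>lam\<close> of \<open>c \<Prod>(c\<^sup>2 - c\<^sub>j\<^sup>2)\<^sup>2\<close> that makes \<open>c\<close> a node too. The previous lemma applies to both
  polynomials, which gives \<open>lam > 0\<close>, and comparing them at \<open>1/2\<close> bounds \<open>lam\<close>; the hypothesis
  \<open>5/8 \<le> c\<^sup>2\<close> makes the factors at \<open>1/2\<close> dominate those at \<open>c\<close>.\<close>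

lemma odd_fun_peaking:
  assumes C: "finite C" "C \<noteq> {}" "\<And>c. c \<in> C \<Longrightarrow> 0 < c \<and> c \<le> 1 \<and> 5/8 \<le> c^2"
  shows "\<exists>r. degree r < 2 * card C \<and>
    (\<forall>c\<in>{-1..1}. odd_fun r c \<le> 1 \<and> (odd_fun r c = 1 \<longleftrightarrow> c \<in> C))"
proof -
  define k where "k = card C"
  have k: "k \<ge> 1" using C by (simp add: k_def Suc_leI card_gt_0_iff)
  define X where "X = (\<lambda>c. c^2) ` C"
  have inj: "inj_on (\<lambda>c. c^2) C"
    using C(3) by (intro inj_onI) (smt (verit) power2_eq_iff_nonneg)
  have X: "finite X" "card X = k"
    using C(1) card_image[OF inj] by (auto simp: X_def k_def)
  \<comment> \<open>The prescribed data are the value and derivative of \<open>1 / sqrt x\<close>,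
    so that \<open>odd_fun r\<close> has value \<open>1\<close> and derivative \<open>0\<close> at
    each node.\<close>
  obtain r where r: "degree r \<le> 2 * k - 1"
    "\<forall>x\<in>X. poly r x = 1 / sqrt x \<and> poly (pderiv r) x = - 1 / (2 * x * sqrt x)"
    using Hermite_interpolation[OF X(1), of "\<lambda>x. 1 / sqrt x" "\<lambda>x. - 1 / (2 * x * sqrt x)"] X(2) by auto
  have val: "odd_fun r c = 1" and dval: "poly (odd_deriv r) (c^2) = 0" if "c \<in> C" for c
  proof -
    have "c > 0" "c^2 \<in> X" using that C(3) X_def by auto
    then have "poly r (c^2) = 1 / c" "poly (pderiv r) (c^2) = - 1 / (2 * c^2 * c)"
      using r(2) by auto
    then show "odd_fun r c = 1" "poly (odd_deriv r) (c^2) = 0"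
      using \<open>c > 0\<close> by (auto simp: odd_fun_def odd_deriv_def power2_eq_square)
  qed
  have pos: "\<And>c. c \<in> C \<Longrightarrow> 0 < c" using C(3) by auto
  have low: "0 < odd_fun r y \<and> odd_fun r y < 1" if "y \<in> {0<..<Min C}" for y
    using odd_fun_below_nodes(1)[OF C(1,2) pos val order.refl dval _ that] r(1) k_def
    by (simp add: mult_2)
  have half: "x > 1/2" if "x^2 \<ge> 5/8" "x \<ge> 0" for x :: real
    using power_mono[of x "1/2" 2] that by (rule_tac ccontr) (auto simp: power2_eq_square)
  have mC: "Min C \<in> C" using C by simp
  then have hm: "1/2 < Min C" using C(3) half by fastforce
  define w where "w = (\<Prod>c\<in>C. [:-(c^2), 1:])"
  have pw: "poly w u = (\<Prod>c\<in>C. u - c^2)" for u by (simp add: w_def poly_prod)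
  have dw: "degree w = k" unfolding w_def by (subst degree_prod_sum_eq) (auto simp: k_def)
  have lw: "lead_coeff w = 1" unfolding w_def by (simp add: lead_coeff_prod)
  have Mm: "c \<noteq> Min C" if "c \<notin> C" for c using mC that by blast
  \<comment> \<open>The lower bound matters as much as the upper one: by oddness it becomes the
    upper bound at \<open>-c\<close>.\<close>
  have mid: "-1 < odd_fun r c \<and> odd_fun r c < 1" if c: "Min C \<le> c" "c \<le> 1" "c \<notin> C" for c
  proof -
    have c0: "0 < c" "Min C < c" using c hm Mm[OF c(3)] by linarith+
    have c2: "5/8 \<le> c^2" "c^2 \<le> 1"
      using c(1,2) C(3)[OF mC] power_mono[of "Min C" c 2] hm by (auto simp: power_le_one intro: order.trans)
    have wc: "poly w (c^2) \<noteq> 0"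
      using c(3) c0 C(1) pos by (auto simp: pw) (smt (verit) power2_eq_iff_nonneg)
    define lam where "lam = (1 - odd_fun r c) / (c * (poly w (c^2))^2)"
    define h where "h = r + smult lam (w * w)"
    have h: "odd_fun h u = odd_fun r u + lam * (u * (poly w (u^2))^2)" for u
      by (simp add: h_def odd_fun_def power2_eq_square algebra_simps)
    have hc: "odd_fun h c = 1" using wc c0 by (simp add: h lam_def)
    have wC: "poly w (u^2) = 0" if "u \<in> C" for u using that C(1) by (auto simp: pw)
    have dh: "degree h \<le> card (insert c C) + card C - 1"
    proof -
      have "degree (smult lam (w * w)) \<le> k + k"
        using degree_mult_le[of w w] dw degree_smult_le order.trans by metis
      then show ?thesis unfolding h_def using r(1) C(1) c(3) k_def
        by (intro degree_add_le) auto
    qed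
    have hval: "odd_fun h u = 1" if "u \<in> insert c C" for u
      using that hc val wC by (auto simp: h)
    have hd: "poly (odd_deriv h) (u^2) = 0" if "u \<in> C" for u
      using dval[OF that] wC[OF that]
      by (simp add: h_def odd_deriv_def pderiv_add pderiv_smult pderiv_mult algebra_simps)
    have p': "\<And>u. u \<in> insert c C \<Longrightarrow> 0 < u" using pos c0 by auto
    have e: "card (insert c C) + card C - 1 = 2 * k" using C(1) c(3) by (simp add: k_def)
    have mi: "Min (insert c C) = Min C"
      using C(1,2) c0(2) by (simp add: min_absorb2 del: Min_less_iff)
    \<comment> \<open>Since \<open>w\<close> is monic of degree \<open>k\<close>, \<open>lam\<close>
      is the top coefficient whose sign \<open>odd_fun_below_nodes\<close> determines.\<close>
    have ch: "coeff h (2 * k) = lam"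
    proof -
      have "coeff (w * w) (2 * k) = 1"
        using coeff_mult_degree_sum[of w w] dw lw by (simp add: mult_2)
      moreover have "coeff r (2 * k) = 0" using r(1) k by (intro coeff_eq_0) linarith
      ultimately show ?thesis by (simp add: h_def)
    qed
    have lam: "lam > 0"
      using odd_fun_below_nodes(2)[OF _ _ p' hval subset_insertI hd dh] C(1) ch unfolding e by simp
    \<comment> \<open>The point \<open>1/2\<close> lies below the first node of both polynomials, so
      \<open>odd_fun h\<close> is below \<open>1\<close> and \<open>odd_fun r\<close> above
      \<open>0\<close> there; the added term is therefore less than \<open>1\<close>.\<close>
    have "odd_fun h (1/2) < 1"
      using odd_fun_below_nodes(1)[OF _ _ p' hval subset_insertI hd dh, of "1/2"] C(1) hm unfolding mi by simp
    moreover have "0 < odd_fun r (1/2)" using low hm by auto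
    ultimately have l1: "lam * (1/2 * (poly w (1/4))^2) < 1"
      using h[of "1/2"] by (simp add: power2_eq_square)
    have "(\<Prod>u\<in>C. \<bar>c^2 - u^2\<bar>) \<le> (\<Prod>u\<in>C. \<bar>1/4 - u^2\<bar>)"
    proof (rule prod_mono, safe)
      \<comment> \<open>Both squares lie between \<open>5/8\<close> and \<open>1\<close>, so they
        are at most \<open>3/8\<close> apart, while \<open>1/4\<close> is at least
        \<open>3/8\<close> away from \<open>u ^ 2\<close>.\<close>
      fix u assume "u \<in> C"
      then have "5/8 \<le> u^2" "u^2 \<le> 1" using C(3) by (auto simp: power_le_one less_imp_le)
      then show "\<bar>c^2 - u^2\<bar> \<le> \<bar>1/4 - u^2\<bar>" using c2 by linarith
    qed simp
    then have "\<bar>poly w (c^2)\<bar> \<le> \<bar>poly w (1/4)\<bar>" by (simp add: pw abs_prod)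
    then have wle: "(poly w (c^2))^2 \<le> (poly w (1/4))^2" by (simp add: abs_le_square_iff)
    have gap: "1 - odd_fun r c = lam * (c * (poly w (c^2))^2)" using h[of c] hc by simp
    have "c * (poly w (c^2))^2 \<le> 1 * (poly w (1/4))^2"
      using wle c c0 by (intro mult_mono) auto
    then have "1 - odd_fun r c \<le> lam * (poly w (1/4))^2"
      unfolding gap using lam by (simp add: mult_left_mono)
    then have "1 - odd_fun r c < 2" using l1 by simp
    moreover have "0 < 1 - odd_fun r c" unfolding gap using lam c0(1) wc by simp
    ultimately show ?thesis by simp
  qed
  have all: "(c \<in> C \<and> odd_fun r c = 1) \<or> (c \<notin> C \<and> -1 < odd_fun r c \<and> odd_fun r c < 1)"
    if c: "0 \<le> c" "c \<le> 1" for c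
  proof -
    consider "c \<in> C" | "c \<notin> C" "c = 0" | "c \<notin> C" "0 < c" "c < Min C" | "c \<notin> C" "Min C \<le> c"
      using c by linarith
    then show ?thesis
    proof cases
      case 2 then show ?thesis by (simp add: odd_fun_def)
    next
      case 3 then show ?thesis using low[of c] by simp
    qed (use val mid c in auto)
  qed
  have neg: "odd_fun r (-c) = - odd_fun r c" for c by (simp add: odd_fun_def)
  have "odd_fun r c \<le> 1 \<and> (odd_fun r c = 1 \<longleftrightarrow> c \<in> C)" if "c \<in> {-1..1}" for c
  proof (cases "c \<ge> 0")
    case True
    then show ?thesis using all[of c] that by auto
  next
    case False
    then have "c \<notin> C" using pos[of c] by auto
    then show ?thesis using all[of "-c"] that False neg[of c] by auto
  qed
  moreover have "degree r < 2 * card C" using r(1) k k_def by linarith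
  ultimately show ?thesis by blast
qed

section \<open>Trigonometric polynomials of fixed parity\<close>

text \<open>The frequencies share the parity of \<open>d\<close>: for odd \<open>d\<close> they are
  odd, as in the coordinates of the curve. The free phase \<open>b\<close> covers sines as
  well.\<close>

inductive trig :: "nat \<Rightarrow> (real \<Rightarrow> real) \<Rightarrow> bool" where
  cos: "r \<le> d \<Longrightarrow> even (d - r) \<Longrightarrow> trig d (\<lambda>t. a * cos (real r * t - b))"
| add: "trig d f \<Longrightarrow> trig d g \<Longrightarrow> trig d (\<lambda>t. f t + g t)"

lemma trig_zero: "trig d (\<lambda>t. 0)"
  using trig.cos[of d d 0] by simp

lemma trig_scale: "trig d f \<Longrightarrow> trig d (\<lambda>t. c * f t)"
proof (induction rule: trig.induct)
  case (cos r d a b)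
  then show ?case using trig.cos[of r d "c * a" b] by (simp add: mult.assoc)
next
  case (add d f g)
  then show ?case using trig.add[of d "\<lambda>t. c * f t" "\<lambda>t. c * g t"] by (simp add: algebra_simps)
qed

lemma trig_sum: "finite I \<Longrightarrow> (\<And>i. i \<in> I \<Longrightarrow> trig d (f i)) \<Longrightarrow> trig d (\<lambda>t. \<Sum>i\<in>I. f i t)"
  by (induction I rule: finite_induct) (auto intro: trig_zero trig.add)

text \<open>The product-to-sum formula moves each frequency one up and one down, which switches the
  parity and raises the degree by one.\<close>

lemma trig_mult_cos: "trig d f \<Longrightarrow> trig (Suc d) (\<lambda>t. f t * cos (t - b))"
proof (induction rule: trig.induct)
  case (cos r d a c)
  have up: "trig (Suc d) (\<lambda>t. a/2 * cos (real (Suc r) * t - (c + b)))"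
    using cos by (intro trig.cos) auto
  have down: "trig (Suc d) (\<lambda>t. a/2 * cos ((real r - 1) * t - (c - b)))"
  proof (cases r)
    \<comment> \<open>Here the lower frequency is \<open>-1\<close>, which evenness of the cosine
      turns into \<open>1\<close>.\<close>
    case 0
    have "(\<lambda>t. a/2 * cos ((real r - 1) * t - (c - b))) = (\<lambda>t. a/2 * cos (real 1 * t - (b - c)))"
      using 0 cos_minus[of "t - (b - c)" for t] by (simp add: algebra_simps)
    then show ?thesis using cos 0 trig.cos[of 1 "Suc d" "a/2" "b - c"] by simp
  next
    case (Suc s)
    then show ?thesis using cos trig.cos[of s "Suc d" "a/2" "c - b"] by simp
  qed
  have "a * cos (real r * t - c) * cos (t - b) =
      a/2 * cos (real (Suc r) * t - (c + b)) + a/2 * cos ((real r - 1) * t - (c - b))" for t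
  proof -
    have "real (Suc r) * t - (c + b) = (real r * t - c) + (t - b)"
      "(real r - 1) * t - (c - b) = (real r * t - c) - (t - b)" by (simp_all add: algebra_simps)
    then show ?thesis by (simp only: cos_times_cos mult.assoc) (simp add: field_simps)
  qed
  then show ?case using trig.add[OF up down] by simp
next
  case (add d f g)
  then show ?case
    using trig.add[of "Suc d" "\<lambda>t. f t * cos (t - b)" "\<lambda>t. g t * cos (t - b)"]
    by (simp add: algebra_simps)
qed

lemma trig_mono2: "trig d f \<Longrightarrow> trig (d + 2 * e) f"
  by (induction rule: trig.induct) (auto intro: trig.intros)

lemma trig_mono: "trig d f \<Longrightarrow> d \<le> d' \<Longrightarrow> even (d' - d) \<Longrightarrow> trig d' f"
  using trig_mono2[of d f "(d' - d) div 2"] by simp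

lemma trig_one: "trig 0 (\<lambda>t. 1)"
  using trig.cos[of 0 0 1 0] by simp

lemma trig_cos_power: "trig d (\<lambda>t. cos (t - b) ^ d)"
proof (induction d)
  case (Suc d)
  show ?case using trig_mult_cos[OF Suc, of b] by (simp add: mult.commute)
qed (simp add: trig_one)

lemma trig_prod_sin: "finite S \<Longrightarrow> trig (card S) (\<lambda>t. \<Prod>s\<in>S. sin (t - s))"
proof (induction S rule: finite_induct)
  case (insert s S)
  have "cos (t - (s + pi/2)) = sin (t - s)" for t
    using cos_minus[of "pi/2 - (t - s)"] by (simp add: sin_cos_eq algebra_simps)
  then show ?case
    using trig_mult_cos[OF insert.IH, of "s + pi/2"] insert.hyps by (simp add: mult.commute)
qed (simp add: trig_one)

lemma trig_periodic: "trig d f \<Longrightarrow> f (t + 2 * pi * of_int z) = f t"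
proof (induction rule: trig.induct)
  case (cos r d a b)
  have "real r * (t + 2 * pi * of_int z) - b = (real r * t - b) + 2 * pi * of_int (int r * z)"
    by (simp add: algebra_simps)
  then show ?case by (simp only: cos_add cos_int_2pin sin_int_2pin) simp
qed simp

lemma trig_odd_fun:
  assumes "2 * degree r + 1 \<le> d" "odd d"
  shows "trig d (\<lambda>t. odd_fun r (cos (t - b)))"
proof -
  have "trig d (\<lambda>t. coeff r i * cos (t - b) ^ (2 * i + 1))" if "i \<in> {..degree r}" for i
    using that assms by (intro trig_scale trig_mono[OF trig_cos_power]) auto
  then have "trig d (\<lambda>t. \<Sum>i\<le>degree r. coeff r i * cos (t - b) ^ (2 * i + 1))"
    by (intro trig_sum) auto
  then show ?thesis
    by (simp add: odd_fun_def poly_altdef sum_distrib_left power_mult[symmetric] mult_ac)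
qed

text \<open>Lagrange interpolation with factors \<open>sin (t - u)\<close>. These vanish also at the
  antipode of \<open>u\<close>, hence the nodes must differ modulo \<open>pi\<close>. The bound
  \<open>Suc d\<close> is the dimension of the function space.\<close>

lemma trig_interpolation:
  assumes S: "finite S" and sep: "\<And>s s'. s \<in> S \<Longrightarrow> s' \<in> S \<Longrightarrow> s \<noteq> s' \<Longrightarrow> sin (s - s') \<noteq> 0"
    and d: "odd d" "card S \<le> Suc d"
  shows "\<exists>f. trig d f \<and> (\<forall>s\<in>S. f s = g s)"
proof -
  have "\<exists>f. trig d f \<and> f s \<noteq> 0 \<and> (\<forall>s'\<in>S - {s}. f s' = 0)" if s: "s \<in> S" for s
  proof -
    define h where "h t = (\<Prod>u\<in>S - {s}. sin (t - u))" for t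
    have c: "card (S - {s}) = card S - 1" "card S > 0" using s S card_gt_0_iff by auto
    have h: "trig (card S - 1) h" using trig_prod_sin[of "S - {s}"] S c by (simp add: h_def[abs_def])
    have hs: "h s \<noteq> 0" using sep s S by (auto simp: h_def)
    have h0: "h s' = 0" if "s' \<in> S - {s}" for s' using that S unfolding h_def
      by (intro prod_zero bexI[of _ s']) auto
    show ?thesis
    proof (cases "even (card S)")
      case True
      then have "trig d h" using h d c by (intro trig_mono[OF h]) auto
      then show ?thesis using hs h0 by blast
    next
      \<comment> \<open>The product has even degree \<open>card S - 1\<close>, the wrong parity. The
        factor \<open>cos (t - s)\<close> repairs it and equals \<open>1\<close> at
        \<open>s\<close>; oddness of \<open>card S\<close> leaves room for the extra degree.\<close>
      case False
      have "card S \<noteq> Suc d" using False d(1) by auto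
      then have "card S \<le> d" using d(2) by simp
      moreover have "trig (card S) (\<lambda>t. h t * cos (t - s))"
        using trig_mult_cos[OF h, of s] c by simp
      moreover have "even (d - card S)" using d(1) False by simp
      ultimately have "trig d (\<lambda>t. h t * cos (t - s))"
        by (simp add: trig_mono)
      then show ?thesis using hs h0 by (intro exI[of _ "\<lambda>t. h t * cos (t - s)"]) auto
    qed
  qed
  then obtain f where f: "\<And>s. s \<in> S \<Longrightarrow> trig d (f s) \<and> f s s \<noteq> 0 \<and> (\<forall>s'\<in>S - {s}. f s s' = 0)"
    by metis
  have "trig d (\<lambda>t. \<Sum>s\<in>S. (g s / f s s) * f s t)"
    using f S by (intro trig_sum trig_scale) auto
  moreover have "(\<Sum>s\<in>S. (g s / f s s) * f s u) = g u" if u: "u \<in> S" for u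
  proof -
    have "(\<Sum>s\<in>S. (g s / f s s) * f s u) = (\<Sum>s\<in>S. if s = u then g u else 0)"
      using f u by (intro sum.cong) auto
    then show ?thesis using S u by simp
  qed
  ultimately show ?thesis by blast
qed

section \<open>Faces of the polytope\<close>

text \<open>The supporting hyperplane cuts out a face, and a face of a finitely generated hull is
  spanned by some of the generators, which must then lie in the hyperplane.\<close>

lemma face_of_convex_hull_maximizers:
  fixes v :: "'a::euclidean_space"
  assumes "finite S" and le: "\<And>x. x \<in> S \<Longrightarrow> v \<bullet> x \<le> b"
  shows "convex hull {x \<in> S. v \<bullet> x = b} face_of convex hull S"
proof -
  have half: "convex hull S \<subseteq> {x. v \<bullet> x \<le> b}"
    using le by (intro hull_minimal) (auto simp: convex_halfspace_le)
  let ?F = "convex hull S \<inter> {x. v \<bullet> x = b}"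
  have F: "?F face_of convex hull S"
    using half by (intro face_of_Int_supporting_hyperplane_le) auto
  obtain S' where S': "S' \<subseteq> S" "?F = convex hull S'"
    using face_of_convex_hull_subset[OF finite_imp_compact[OF assms(1)] F] by blast
  have "S' \<subseteq> {x. v \<bullet> x = b}" using S'(2) hull_subset[of S' convex] by blast
  then have "?F \<subseteq> convex hull {x \<in> S. v \<bullet> x = b}"
    unfolding S'(2) using S'(1) by (intro hull_mono) blast
  moreover have "convex hull {x \<in> S. v \<bullet> x = b} \<subseteq> ?F"
    by (intro hull_minimal Int_greatest hull_mono convex_Int convex_hyperplane convex_convex_hull)
      (auto intro: hull_inc)
  ultimately show ?thesis using F by (metis subset_antisym)
qed

section \<open>Frequencies of the coordinate functions\<close>

definition freq :: "nat \<Rightarrow> nat \<Rightarrow> nat" where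
  "freq k i = 5 ^ (i div (6 * k)) * (2 * (i mod (6 * k) div 2) + 1)"

lemma Psi_eq:
  assumes "i < 6 * k * (m + 1)"
  shows "Psi k m t i = (if even i then cos (real (freq k i) * t) else sin (real (freq k i) * t))"
proof -
  have "i mod (6 * k) < 2 * (3 * k)" using assms by (cases "k = 0") auto
  moreover have "even (i mod (6 * k)) = even i" by (simp add: dvd_mod_iff)
  ultimately show ?thesis
    using assms by (simp add: Psi_def U_def freq_def algebra_simps)
qed

text \<open>Locates a harmonic in block \<open>i\<close>: \<open>e = 0\<close> is its cosine
  coordinate, \<open>e = 1\<close> its sine coordinate.\<close>

lemma freq_index:
  assumes "r < 3 * k" "e < 2"
  shows "freq k (6 * k * i + 2 * r + e) = 5 ^ i * (2 * r + 1)"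
proof -
  have "2 * r + e < 6 * k" using assms by linarith
  then have "(6 * k * i + 2 * r + e) div (6 * k) = i" "(6 * k * i + 2 * r + e) mod (6 * k) = 2 * r + e"
    by (simp_all add: add.assoc)
  then show ?thesis using assms(2) by (simp add: freq_def)
qed

section \<open>Vertices as residues modulo \<open>N\<close>, and faces cut out by trigonometric
  functionals\<close>

locale curve_polytope =
  fixes k m n :: nat and beta :: "'n::finite \<Rightarrow> nat"
  assumes k: "k \<ge> 1" and n: "n > 0" "even n"
    and beta: "bij_betw beta UNIV {..<6 * k * (m + 1)}"
begin

definition N :: nat where "N = n * 5 ^ m"

definition pt :: "nat \<Rightarrow> real" where "pt j = 2 * pi * real j / real N"

abbreviation vert :: "nat \<Rightarrow> real ^ 'n" where "vert j \<equiv> PsiVec k m beta (pt j)"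

lemma N_pos: "N > 0" and N_even: "even N"
  using n by (auto simp: N_def)

lemma A_eq: "A m n = pt ` {..<N}"
  by (auto simp: A_def pt_def N_def image_def)

lemma Ptope_eq: "Ptope k m n beta = convex hull (vert ` {..<N})"
  by (simp add: Ptope_def A_eq image_image)

lemma beta_ex: "i < 6 * k * (m + 1) \<Longrightarrow> \<exists>l. beta l = i"
  using beta by (metis bij_betw_iff_bijections lessThan_iff)

lemma beta_less: "beta l < 6 * k * (m + 1)"
  using beta by (metis bij_betwE UNIV_I lessThan_iff)

text \<open>Block \<open>i\<close> of the curve lists cosine and sine of every odd frequency below
  \<open>6 * k\<close> at the angle \<open>5 ^ i * t\<close>; the addition formula combines such a
  pair into a cosine of arbitrary phase.\<close>

lemma functional_of_trig:
  assumes "trig d f" "d = 6 * k - 1" "i \<le> m"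
  shows "\<exists>v. \<forall>t. v \<bullet> PsiVec k m beta t = f (5 ^ i * t)"
  using assms
proof (induction rule: trig.induct)
  case (cos r d a b)
  have "odd d" using k cos.prems by auto
  then have "odd r" using cos.hyps by auto
  then obtain s where s: "r = 2 * s + 1" by (auto elim: oddE)
  have s': "s < 3 * k" using cos s k by linarith
  have lt: "6 * k * i + 2 * s + e < 6 * k * (m + 1)" if "e < 2" for e
  proof -
    have "6 * k * i \<le> 6 * k * m" using cos.prems(2) by simp
    then have "6 * k * i + 2 * s + e < 6 * k * m + 6 * k" using s' that by linarith
    then show ?thesis by simp
  qed
  obtain l0 l1 where l: "beta l0 = 6 * k * i + 2 * s + 0" "beta l1 = 6 * k * i + 2 * s + 1"
    using beta_ex[OF lt[of 0]] beta_ex[OF lt[of 1]] by auto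
  have 0: "axis l0 1 \<bullet> PsiVec k m beta t = cos (real (5 ^ i * r) * t)" for t
    unfolding inner_axis' PsiVec_def
    using lt[of 0] freq_index[OF s', of 0 i] by (simp add: l s Psi_eq)
  have 1: "axis l1 1 \<bullet> PsiVec k m beta t = sin (real (5 ^ i * r) * t)" for t
    unfolding inner_axis' PsiVec_def
    using lt[of 1] freq_index[OF s', of 1 i] by (simp add: l s Psi_eq)
  have "((a * cos b) *\<^sub>R axis l0 1 + (a * sin b) *\<^sub>R axis l1 1) \<bullet> PsiVec k m beta t
      = a * cos (real r * (5 ^ i * t) - b)" for t
    by (simp only: inner_add_left inner_scaleR_left 0 1) (simp add: cos_diff algebra_simps)
  then show ?case by blast
next
  case (add d f g)
  then obtain v w where "\<forall>t. v \<bullet> PsiVec k m beta t = f (5 ^ i * t)"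
      "\<forall>t. w \<bullet> PsiVec k m beta t = g (5 ^ i * t)" by auto
  then show ?case by (intro exI[of _ "v + w"]) (simp add: inner_add_left)
qed

lemma pt_cong:
  assumes "[x = y] (mod N)"
  obtains z :: int where "pt x = pt y + 2 * pi * of_int z"
proof -
  have "[int y = int x] (mod int N)" using assms by (simp add: cong_int_iff cong_sym_eq)
  then obtain z where z: "int x = int y + int N * z" by (auto simp: cong_iff_lin)
  have "real x = real y + real N * of_int z"
    using arg_cong[OF z, of real_of_int] by simp
  then have "pt x = pt y + 2 * pi * of_int z"
    using N_pos by (simp add: pt_def field_simps)
  then show thesis using that by blast
qed

lemma trig_pt_cong: "trig d f \<Longrightarrow> [x = y] (mod N) \<Longrightarrow> f (pt x) = f (pt y)"
  using trig_periodic by (elim pt_cong) simp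

lemma cos_pt_cong: "[x = y] (mod N) \<Longrightarrow> cos (pt x - b) = cos (pt y - b)"
  using trig_pt_cong[OF trig.cos[of 1 1 1 b]] by simp

lemma pt_mult: "a * pt j = pt (a' * j)" if "a = real a'"
  using that by (simp add: pt_def)

lemma pt_half: "pt (y + N div 2) = pt y + pi"
proof -
  have "real (N div 2) = real N / 2" using N_even by (simp add: real_of_nat_div)
  then show ?thesis using N_pos by (simp add: pt_def field_simps)
qed

text \<open>Even multiples of \<open>pi\<close> give the same residue, odd multiples the antipodal
  one; half a turn is the index shift \<open>N div 2\<close>.\<close>

lemma sin_pt_eq_0:
  assumes "sin (pt x - pt y) = 0"
  shows "[x = y] (mod N) \<or> [x = y + N div 2] (mod N)"
proof -
  obtain z :: int where "pt x - pt y = of_int z * pi" using assms sin_zero_iff_int2 by blast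
  then have "2 * (real x - real y) = real N * of_int z"
  proof -
    assume "pt x - pt y = of_int z * pi"
    then have "pi * (2 * (real x - real y)) = pi * (real N * of_int z)"
      using N_pos by (simp add: pt_def field_simps)
    then show ?thesis by simp
  qed
  then have "of_int (2 * (int x - int y)) = (of_int (int N * z) :: real)" by simp
  then have e: "2 * (int x - int y) = int N * z" by (simp only: of_int_eq_iff)
  have M: "int N = 2 * int (N div 2)" using N_even by (simp add: zdiv_int)
  show ?thesis
  proof (cases "even z")
    case True
    then obtain w where "z = 2 * w" by (auto elim: evenE)
    then have "int x = int y + int N * w" using e by simp
    then have "[int x = int y] (mod int N)" by (simp add: cong_def)
    then show ?thesis by (simp add: cong_int_iff)
  next
    case False
    then obtain w where "z = 2 * w + 1" by (auto elim: oddE)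
    then have "2 * int x = 2 * (int (y + N div 2) + int N * w)" using e M by (simp add: algebra_simps)
    then have "int x = int (y + N div 2) + int N * w" by simp
    then have "[int x = int (y + N div 2)] (mod int N)" by (simp only: cong_def) simp
    then have "[x = y + N div 2] (mod N)" by (simp only: cong_int_iff)
    then show ?thesis by blast
  qed
qed

text \<open>Stated for a subset \<open>D\<close> of the indices, so that faces of faces can be cut
  out one after another.\<close>

lemma face_restrict:
  assumes D: "D \<subseteq> {..<N}" and i: "i \<le> m" and f: "trig (6 * k - 1) f"
    and le: "\<And>j. j \<in> D \<Longrightarrow> f (pt (5 ^ i * j)) \<le> 1"
  shows "convex hull (vert ` {j \<in> D. f (pt (5 ^ i * j)) = 1}) face_of convex hull (vert ` D)"
proof -
  obtain v where v: "\<And>t. v \<bullet> PsiVec k m beta t = f (5 ^ i * t)"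
    using functional_of_trig[OF f refl i] by blast
  have vp: "v \<bullet> vert j = f (pt (5 ^ i * j))" for j
    using v pt_mult[of "5 ^ i" "5 ^ i"] by simp
  have "convex hull {x \<in> vert ` D. v \<bullet> x = 1} face_of convex hull (vert ` D)"
    using D le by (intro face_of_convex_hull_maximizers) (auto simp: vp finite_subset)
  moreover have "{x \<in> vert ` D. v \<bullet> x = 1} = vert ` {j \<in> D. f (pt (5 ^ i * j)) = 1}"
    by (auto simp: vp)
  ultimately show ?thesis by simp
qed

text \<open>Interpolates the indicator of the residues of \<open>T\<close> at scale
  \<open>5 ^ i\<close>. Degree \<open>6 * k - 1\<close> allows \<open>6 * k\<close> nodes, and the
  absence of antipodes is the separation that interpolation by sines demands.\<close>

lemma face_interpolate:
  assumes D: "D \<subseteq> {..<N}" and T: "T \<subseteq> D" and i: "i \<le> m"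
    and card: "card ((\<lambda>j. 5 ^ i * j mod N) ` D) \<le> 6 * k"
    and anti: "\<And>j j'. j \<in> D \<Longrightarrow> j' \<in> D \<Longrightarrow> \<not> [5 ^ i * j = 5 ^ i * j' + N div 2] (mod N)"
  shows "convex hull (vert ` {j \<in> D. \<exists>t\<in>T. [5 ^ i * j = 5 ^ i * t] (mod N)}) face_of convex hull (vert ` D)"
proof -
  define S where "S = (\<lambda>j. 5 ^ i * j mod N) ` D"
  have fin: "finite S" using D finite_subset by (auto simp: S_def)
  have S_less: "x < N" if "x \<in> S" for x using that N_pos by (auto simp: S_def)
  have sep: "sin (pt x - pt y) \<noteq> 0" if xy: "x \<in> S" "y \<in> S" "x \<noteq> y" for x y
  proof
    assume "sin (pt x - pt y) = 0"
    then consider "[x = y] (mod N)" | "[x = y + N div 2] (mod N)" using sin_pt_eq_0 by blast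
    then show False
    proof cases
      case 1
      then show False using xy S_less cong_less_modulus_unique_nat by blast
    next
      case 2
      obtain j j' where j: "j \<in> D" "j' \<in> D" "x = 5 ^ i * j mod N" "y = 5 ^ i * j' mod N"
        using xy by (auto simp: S_def)
      have "[5 ^ i * j = 5 ^ i * j' + N div 2] (mod N)"
        using 2 by (simp add: j(3,4) cong_def mod_simps)
      then show False using anti j by blast
    qed
  qed
  have inj: "inj_on pt S" using sep by (intro inj_onI) (metis diff_self sin_zero)
  have "odd (6 * k - 1)" "card (pt ` S) \<le> Suc (6 * k - 1)"
    using k card card_image[OF inj] by (auto simp: S_def)
  then obtain f where f: "trig (6 * k - 1) f"
     "\<forall>s\<in>pt ` S. f s = (if s \<in> pt ` (\<lambda>j. 5 ^ i * j mod N) ` T then 1 else 0)"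
    using trig_interpolation[of "pt ` S" "6 * k - 1" "\<lambda>s. if s \<in> pt ` (\<lambda>j. 5 ^ i * j mod N) ` T then 1 else 0"] sep fin
    by blast
  have val: "f (pt (5 ^ i * j)) = (if \<exists>t\<in>T. [5 ^ i * j = 5 ^ i * t] (mod N) then 1 else 0)"
    if j: "j \<in> D" for j
  proof -
    have "f (pt (5 ^ i * j)) = f (pt (5 ^ i * j mod N))"
      by (intro trig_pt_cong[OF f(1)]) (simp add: cong_def)
    moreover have "5 ^ i * j mod N \<in> S" using j by (simp add: S_def)
    moreover have "pt (5 ^ i * j mod N) \<in> pt ` (\<lambda>j. 5 ^ i * j mod N) ` T \<longleftrightarrow>
        5 ^ i * j mod N \<in> (\<lambda>j. 5 ^ i * j mod N) ` T"
      using inj j T by (intro inj_on_image_mem_iff[OF inj]) (auto simp: S_def)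
    ultimately show ?thesis using f(2) by (auto simp: cong_def image_iff)
  qed
  have "{j \<in> D. \<exists>t\<in>T. [5 ^ i * j = 5 ^ i * t] (mod N)} = {j \<in> D. f (pt (5 ^ i * j)) = 1}"
    by (intro Collect_cong conj_cong refl) (simp add: val)
  moreover have "f (pt (5 ^ i * j)) \<le> 1" if "j \<in> D" for j
    unfolding val[OF that] by simp
  ultimately show ?thesis using face_restrict[OF D i f(1)] by simp
qed


lemma cong_of_pt_diff:
  assumes "pt x - pt y = 2 * pi * of_int z"
  shows "[x = y] (mod N)"
proof -
  have "pi * (real x - real y) = pi * (real N * of_int z)"
    using assms N_pos by (simp add: pt_def field_simps)
  then have "real x - real y = real N * of_int z" by simp
  then have "real_of_int (int x - int y) = of_int (int N * z)" by simp
  then have "int x = int y + int N * z" by (simp only: of_int_eq_iff)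
  then have "[int x = int y] (mod int N)" by (simp add: cong_def)
  then show ?thesis by (simp only: cong_int_iff)
qed

text \<open>A level set of the cosine on the circle consists of a point and its mirror image about
  \<open>b\<close>.\<close>

lemma card_cos_pt_eq: "card {y. y < N \<and> cos (pt y - b) = cos (pt x - b)} \<le> 2"
proof -
  \<comment> \<open>\<open>B\<close> holds the index of the mirror image of \<open>x\<close>, if the
    mirror image falls on an index at all.\<close>
  define B where "B = {y. y < N \<and> sin ((pt y - b + (pt x - b)) / 2) = 0}"
  have "y = y'" if y: "y \<in> B" "y' \<in> B" for y y'
  proof -
    obtain z z' :: int where "(pt y - b + (pt x - b)) / 2 = of_int z * pi"
      "(pt y' - b + (pt x - b)) / 2 = of_int z' * pi"
      using y by (auto simp: B_def sin_zero_iff_int2)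
    then have "pt y - pt y' = 2 * pi * of_int (z - z')" by (simp add: algebra_simps)
    from cong_of_pt_diff[OF this] show ?thesis
      using y cong_less_modulus_unique_nat by (auto simp: B_def)
  qed
  moreover have "finite B" by (simp add: B_def)
  ultimately have B: "card B \<le> 1" by (simp add: card_le_Suc0_iff_eq)
  have "{y. y < N \<and> cos (pt y - b) = cos (pt x - b)} \<subseteq> insert (x mod N) B"
  proof
    fix y assume y: "y \<in> {y. y < N \<and> cos (pt y - b) = cos (pt x - b)}"
    then have "sin ((pt y - b + (pt x - b)) / 2) * sin ((pt x - b - (pt y - b)) / 2) = 0"
      using cos_diff_cos[of "pt y - b" "pt x - b"] by simp
    then consider "y \<in> B" | "sin ((pt x - pt y) / 2) = 0" using y by (auto simp: B_def)
    then show "y \<in> insert (x mod N) B"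
    proof cases
      case 2
      then obtain z :: int where "(pt x - pt y) / 2 = of_int z * pi" by (auto simp: sin_zero_iff_int2)
      then have "[x = y] (mod N)" by (intro cong_of_pt_diff[of x y z]) simp
      then show ?thesis using y by (simp add: cong_def)
    qed simp
  qed
  then have "card {y. y < N \<and> cos (pt y - b) = cos (pt x - b)} \<le> card (insert (x mod N) B)"
    using \<open>finite B\<close> by (intro card_mono) auto
  also have "\<dots> \<le> 2" using B card_insert_le_m1[of 2 B] by simp
  finally show ?thesis .
qed

text \<open>Two solutions differ by a multiple of \<open>N div 5\<close>, so their quotients by
  \<open>N div 5\<close> tell them apart.\<close>

lemma card_quintuple_preimage:
  assumes "5 dvd N"
  shows "card {y. y < N \<and> [5 * y = 5 * x] (mod N)} \<le> 5"
proof -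
  obtain M where M: "N = 5 * M" using assms by (auto elim: dvdE)
  then have "M > 0" using N_pos by simp
  let ?S = "{y. y < N \<and> [5 * y = 5 * x] (mod N)}"
  have "inj_on (\<lambda>y. y div M) ?S"
  proof (rule inj_onI)
    fix y z assume yz: "y \<in> ?S" "z \<in> ?S" "y div M = z div M"
    then have "5 * y mod (5 * M) = 5 * z mod (5 * M)" by (simp add: cong_def M)
    then have "y mod M = z mod M" by (simp add: mult_mod_right[symmetric])
    then show "y = z" using yz(3) by (metis div_mult_mod_eq)
  qed
  moreover have "(\<lambda>y. y div M) ` ?S \<subseteq> {..<5}"
    using M \<open>M > 0\<close> by (auto simp: less_mult_imp_div_less)
  ultimately have "card ?S \<le> card {..<5::nat}" by (rule card_inj_on_le) simp
  then show ?thesis by simp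
qed

text \<open>Serves with \<open>c = 2\<close> for mirror images and \<open>c = 5\<close> for
  preimages under multiplication by five; both fit into the \<open>6 * k\<close> interpolation
  nodes.\<close>

lemma card_UN_bound:
  assumes "finite T" "card T \<le> k" "\<And>t. t \<in> T \<Longrightarrow> card (B t) \<le> c" "c \<le> 6"
    and "S \<subseteq> (\<Union>t\<in>T. B t)" "\<And>t. t \<in> T \<Longrightarrow> finite (B t)"
  shows "card S \<le> 6 * k"
proof -
  have "card S \<le> card (\<Union>t\<in>T. B t)" using assms by (intro card_mono) auto
  also have "\<dots> \<le> (\<Sum>t\<in>T. card (B t))" by (rule card_UN_le[OF assms(1)])
  also have "\<dots> \<le> (\<Sum>t\<in>T. 6)" using assms(3,4) by (intro sum_mono) (meson order.trans)
  also have "\<dots> \<le> 6 * k" using assms(2) by simp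
  finally show ?thesis .
qed

text \<open>The cosine hypothesis places the angles \<open>5 ^ i * t\<close> near \<open>b\<close>,
  where a peaking polynomial is available. Distinct indices may coincide after scaling, which the
  descent on the exponent undoes.\<close>

lemma face_of_arc:
  assumes T: "T \<subseteq> {..<N}" "T \<noteq> {}" "card T \<le> k" and i: "i \<le> m"
    and arc: "\<And>t. t \<in> T \<Longrightarrow> 0 < cos (pt (5 ^ i * t) - b) \<and> 5/8 \<le> (cos (pt (5 ^ i * t) - b))^2"
  shows "convex hull (vert ` T) face_of convex hull (vert ` {..<N})"
proof -
  let ?c = "\<lambda>j. cos (pt (5 ^ i * j) - b)"
  have fT: "finite T" using T(1) finite_subset by blast
  define C where "C = ?c ` T"
  have C: "finite C" "C \<noteq> {}" using fT T(2) by (auto simp: C_def)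
  have arc': "0 < c \<and> c \<le> 1 \<and> 5/8 \<le> c^2" if "c \<in> C" for c
    using arc that by (auto simp: C_def)
  have cC: "card C \<le> k" unfolding C_def using card_image_le[OF fT] T(3) order.trans by blast
  obtain r where r: "degree r < 2 * card C"
    "\<forall>c\<in>{-1..1}. odd_fun r c \<le> 1 \<and> (odd_fun r c = 1 \<longleftrightarrow> c \<in> C)"
    using odd_fun_peaking[OF C arc'] by blast
  define f where "f t = odd_fun r (cos (t - b))" for t
  \<comment> \<open>As \<open>degree r\<close> is below \<open>2 * card C\<close>, the degree in the
    cosine is at most \<open>4 * k - 1\<close>, within the allowed \<open>6 * k - 1\<close>.\<close>
  have f: "trig (6 * k - 1) f"
    unfolding f_def[abs_def] using r(1) cC k by (intro trig_odd_fun) auto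
  define D where "D = {j \<in> {..<N}. f (pt (5 ^ i * j)) = 1}"
  have D: "D = {j. j < N \<and> ?c j \<in> ?c ` T}"
    using r(2) unfolding C_def by (auto simp: D_def f_def)
  have DP: "convex hull (vert ` D) face_of convex hull (vert ` {..<N})"
    unfolding D_def using r(2) by (intro face_restrict i f) (auto simp: f_def)
  have TD: "T \<subseteq> D" using T(1) by (auto simp: D)
  \<comment> \<open>Positive cosines put all scaled points of \<open>D\<close> in an open half
    circle, which contains no antipodal pair.\<close>
  have pos: "0 < ?c j" if "j \<in> D" for j
  proof -
    obtain t where "t \<in> T" "?c j = ?c t" using \<open>j \<in> D\<close> unfolding D by blast
    then show ?thesis using arc[of t] by simp
  qed
  have anti: "\<not> [5 ^ i * j = 5 ^ i * j' + N div 2] (mod N)" if j: "j \<in> D" "j' \<in> D" for j j'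
  proof
    assume "[5 ^ i * j = 5 ^ i * j' + N div 2] (mod N)"
    then have "?c j = cos (pt (5 ^ i * j' + N div 2) - b)" by (rule cos_pt_cong)
    also have "\<dots> = cos (pt (5 ^ i * j') - b + pi)" unfolding pt_half by (rule arg_cong[of _ _ cos]) simp
    also have "\<dots> = - ?c j'" by simp
    finally show False using pos[OF j(1)] pos[OF j(2)] by linarith
  qed
  \<comment> \<open>\<open>Z l\<close> gathers all indices that scaling by \<open>5 ^ l\<close>
    cannot distinguish from \<open>T\<close>; \<open>Z i\<close> is cut out of \<open>D\<close>, and
    the descent ends at \<open>Z 0 = T\<close>.\<close>
  define Z where "Z l = {j. j < N \<and> (\<exists>t\<in>T. [5 ^ l * j = 5 ^ l * t] (mod N))}" for l
  have TZ: "T \<subseteq> Z l" for l using T(1) by (auto simp: Z_def intro: cong_refl)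
  have "Z i = {j \<in> D. \<exists>t\<in>T. [5 ^ i * j = 5 ^ i * t] (mod N)}"
    using cos_pt_cong by (auto simp: Z_def D)
  moreover have "card ((\<lambda>j. 5 ^ i * j mod N) ` D) \<le> 6 * k"
  proof (rule card_UN_bound[OF fT T(3) card_cos_pt_eq])
    show "(\<lambda>j. 5 ^ i * j mod N) ` D \<subseteq>
        (\<Union>t\<in>T. {y. y < N \<and> cos (pt y - b) = cos (pt (5 ^ i * t) - b)})"
    proof
      fix y assume "y \<in> (\<lambda>j. 5 ^ i * j mod N) ` D"
      then obtain j t where j: "y = 5 ^ i * j mod N" "t \<in> T" "?c j = ?c t" by (auto simp: D)
      have "cos (pt y - b) = ?c j" by (intro cos_pt_cong) (simp add: j cong_def)
      then show "y \<in> (\<Union>t\<in>T. {y. y < N \<and> cos (pt y - b) = cos (pt (5 ^ i * t) - b)})"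
        using j N_pos by auto
    qed
  qed auto
  ultimately have Zi: "convex hull (vert ` Z i) face_of convex hull (vert ` {..<N})"
    using face_interpolate[OF _ TD i _ anti] DP by (auto simp: D intro: face_of_trans)
  have step: "convex hull (vert ` Z l) face_of convex hull (vert ` {..<N})"
    if l: "l < i" and IH: "convex hull (vert ` Z (Suc l)) face_of convex hull (vert ` {..<N})" for l
  proof -
    have up: "[5 ^ (l + e) * j = 5 ^ (l + e) * t] (mod N)" if "[5 ^ l * j = 5 ^ l * t] (mod N)" for j t l e
      using cong_scalar_left[OF that, of "5 ^ e"] by (simp add: power_add mult_ac)
    have Zl: "Z l = {j \<in> Z (Suc l). \<exists>t\<in>T. [5 ^ l * j = 5 ^ l * t] (mod N)}"
      using up[where e = 1] by (auto simp: Z_def)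
    have card: "card ((\<lambda>j. 5 ^ l * j mod N) ` Z (Suc l)) \<le> 6 * k"
    proof (rule card_UN_bound[OF fT T(3) card_quintuple_preimage])
      show "5 dvd N" using l i by (auto simp: N_def)
      show "(\<lambda>j. 5 ^ l * j mod N) ` Z (Suc l) \<subseteq>
          (\<Union>t\<in>T. {y. y < N \<and> [5 * y = 5 * (5 ^ l * t)] (mod N)})"
        using N_pos by (auto simp: Z_def cong_def mod_simps mult_ac)
    qed auto
    have anti': "\<not> [5 ^ l * j = 5 ^ l * j' + N div 2] (mod N)"
      if j: "j \<in> Z (Suc l)" "j' \<in> Z (Suc l)" for j j'
    proof
      \<comment> \<open>An antipodal pair at scale \<open>5 ^ l\<close> stays antipodal at scale
        \<open>5 ^ i\<close>, the multiplier being odd. There \<open>j\<close> and \<open>j'\<close>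
        may be replaced by points of \<open>T\<close>, for which \<open>anti\<close> excludes
        antipodes.\<close>
      assume a: "[5 ^ l * j = 5 ^ l * j' + N div 2] (mod N)"
      obtain t t' where t: "t \<in> T" "[5 ^ Suc l * j = 5 ^ Suc l * t] (mod N)"
        "t' \<in> T" "[5 ^ Suc l * j' = 5 ^ Suc l * t'] (mod N)" using j by (auto simp: Z_def)
      define e where "e = i - Suc l"
      have e: "Suc l + e = i" using l by (simp add: e_def)
      have t1: "[5 ^ i * j = 5 ^ i * t] (mod N)" "[5 ^ i * j' = 5 ^ i * t'] (mod N)"
        using up[OF t(2), of e] up[OF t(4), of e] by (simp_all only: e)
      obtain w :: nat where w: "5 ^ (Suc e) = 2 * w + 1"
        by (rule oddE[of "5 ^ Suc e :: nat"]) simp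
      obtain M where M: "N = 2 * M" using N_even by (auto elim: evenE)
      have "5 ^ (Suc e) * (N div 2) = N div 2 + N * w"
        unfolding w by (simp add: M algebra_simps)
      moreover have "5 ^ Suc e * 5 ^ l = (5 ^ i :: nat)"
        using e by (metis add.commute add_Suc_shift power_add)
      ultimately have "[5 ^ i * j = 5 ^ i * j' + (N div 2 + N * w)] (mod N)"
        using cong_scalar_left[OF a, of "5 ^ Suc e"]
        by (simp only: distrib_left mult.assoc[symmetric])
      then have "[5 ^ i * j = 5 ^ i * j' + N div 2] (mod N)"
        by (simp add: cong_def add.assoc[symmetric])
      moreover have "[5 ^ i * j' + N div 2 = 5 ^ i * t' + N div 2] (mod N)"
        using t1(2) by (simp add: cong_add_rcancel_nat)
      ultimately have "[5 ^ i * t = 5 ^ i * t' + N div 2] (mod N)"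
        using t1(1) by (meson cong_sym cong_trans)
      then show False using anti TD t by blast
    qed
    have "Z (Suc l) \<subseteq> {..<N}" "l \<le> m" using l i by (auto simp: Z_def)
    from face_interpolate[OF this(1) TZ this(2) card anti']
    have "convex hull (vert ` Z l) face_of convex hull (vert ` Z (Suc l))"
      unfolding Zl by blast
    then show ?thesis using IH face_of_trans by blast
  qed
  have "convex hull (vert ` Z 0) face_of convex hull (vert ` {..<N})"
    using le0[of i] Zi by (rule inc_induct) (use step in blast)
  moreover have "Z 0 = T"
    using T(1) by (auto simp: Z_def intro: cong_refl dest!: cong_less_modulus_unique_nat)
  ultimately show ?thesis by simp
qed

end

section \<open>Counting tuples and frequencies\<close>

text \<open>Mixed radix: the lowest place has base \<open>n\<close>, the places above it base
  5.\<close>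

definition digit :: "nat \<Rightarrow> nat \<Rightarrow> nat \<Rightarrow> nat" where
  "digit n l j = j div (n * 5 ^ l) mod 5"

text \<open>The index tuples to which the arc argument applies in no place; they contain every bad
  tuple.\<close>

definition nonconst_tuples :: "nat \<Rightarrow> nat \<Rightarrow> nat \<Rightarrow> (nat \<Rightarrow> nat) set" where
  "nonconst_tuples k m n = {js \<in> {..<k} \<rightarrow>\<^sub>E {..<n * 5 ^ m}.
     \<forall>l<m. \<not> (\<exists>d. \<forall>a<k. digit n l (js a) = d)}"

text \<open>The \<open>b\<close> constant tuples are pairwise distinct because
  \<open>k >= 1\<close>, and they are disjoint from the tuples counted.\<close>

lemma card_nonconst:
  assumes "k \<ge> 1"
  shows "card {ds \<in> {..<k} \<rightarrow>\<^sub>E {..<b::nat}. \<not> (\<exists>d. \<forall>a<k. ds a = d)} \<le> b ^ k - b"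
proof -
  let ?K = "(\<lambda>d. \<lambda>a\<in>{..<k}. d) ` {..<b}"
  let ?NC = "{ds \<in> {..<k} \<rightarrow>\<^sub>E {..<b}. \<not> (\<exists>d. \<forall>a<k. ds a = d)}"
  have fin: "finite ({..<k} \<rightarrow>\<^sub>E {..<b})" by (intro finite_PiE) auto
  have "inj_on (\<lambda>d. \<lambda>a\<in>{..<k}. d) {..<b}"
    using assms by (intro inj_onI) (metis One_nat_def Suc_le_lessD lessThan_iff restrict_apply')
  then have cK: "card ?K = b" by (simp add: card_image)
  have "card (?K \<union> ?NC) = card ?K + card ?NC"
    using fin by (intro card_Un_disjoint) auto
  moreover have "card (?K \<union> ?NC) \<le> card ({..<k} \<rightarrow>\<^sub>E {..<b})"
    using fin by (intro card_mono Un_least image_subsetI restrict_PiE_iff[THEN iffD2]) auto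
  ultimately show ?thesis by (simp add: cK card_PiE)
qed

lemma digit_mod:
  assumes "l < m"
  shows "digit n l (j mod (n * 5 ^ m)) = digit n l j"
proof -
  obtain e where e: "m = l + Suc e" using assms less_iff_Suc_add by auto
  have "n * 5 ^ m = (n * 5 ^ l) * (5 * 5 ^ e)" by (simp add: e power_add)
  then have "j mod (n * 5 ^ m) = (n * 5 ^ l) * (j div (n * 5 ^ l) mod (5 * 5 ^ e)) + j mod (n * 5 ^ l)"
    by (simp only: mod_mult2_eq)
  then show ?thesis
    by (cases "n = 0") (simp_all add: digit_def mod_mod_cancel)
qed

text \<open>Splitting off the top digit of every entry is injective; the remainders satisfy the
  conditions for smaller \<open>m\<close>, and the top digits form a nonconstant tuple.\<close>

lemma card_nonconst_tuples:
  assumes "k \<ge> 1" "n > 0"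
  shows "card (nonconst_tuples k m n) \<le> n ^ k * (5 ^ k - 5) ^ m"
proof (induction m)
  case 0
  show ?case by (simp add: nonconst_tuples_def card_PiE)
next
  case (Suc m)
  let ?q = "n * 5 ^ m"
  let ?NC = "{ds \<in> {..<k} \<rightarrow>\<^sub>E {..<5::nat}. \<not> (\<exists>d. \<forall>a<k. ds a = d)}"
  let ?h = "\<lambda>js. (\<lambda>a\<in>{..<k}. js a mod ?q, \<lambda>a\<in>{..<k}. js a div ?q)"
  have q: "?q > 0" using assms by simp
  have fin: "finite (nonconst_tuples k m n)" "finite ?NC"
    unfolding nonconst_tuples_def by (simp_all add: finite_PiE)
  have inj: "inj_on ?h (nonconst_tuples k (Suc m) n)"
  proof (rule inj_onI)
    fix f g assume fg: "f \<in> nonconst_tuples k (Suc m) n" "g \<in> nonconst_tuples k (Suc m) n" "?h f = ?h g"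
    have "f a = g a" if a: "a < k" for a
    proof -
      have "f a mod ?q = g a mod ?q" "f a div ?q = g a div ?q"
        using fg(3) a by (auto dest!: fun_cong[of _ _ a])
      then show ?thesis by (metis div_mult_mod_eq)
    qed
    moreover have "f \<in> {..<k} \<rightarrow>\<^sub>E {..<n * 5 ^ Suc m}" "g \<in> {..<k} \<rightarrow>\<^sub>E {..<n * 5 ^ Suc m}"
      using fg by (simp_all only: nonconst_tuples_def mem_Collect_eq)
    ultimately show "f = g" by (intro PiE_ext) auto
  qed
  have "?h js \<in> nonconst_tuples k m n \<times> ?NC" if js: "js \<in> nonconst_tuples k (Suc m) n" for js
  proof -
    have less: "js a div ?q < 5" if "a < k" for a
    proof -
      have "js a < 5 * ?q" using js that by (auto simp: nonconst_tuples_def PiE_def Pi_def algebra_simps)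
      then show ?thesis by (simp add: less_mult_imp_div_less)
    qed
    have nc: "\<not> (\<exists>d. \<forall>a<k. digit n l (js a) = d)" if "l < Suc m" for l
      using js that by (auto simp: nonconst_tuples_def)
    have "\<not> (\<exists>d. \<forall>a<k. digit n l ((\<lambda>a\<in>{..<k}. js a mod ?q) a) = d)" if "l < m" for l
      using nc[of l] that by (simp add: digit_mod)
    then have "(\<lambda>a\<in>{..<k}. js a mod ?q) \<in> nonconst_tuples k m n"
      using q by (simp only: nonconst_tuples_def) auto
    moreover have "digit n m (js a) = js a div ?q" if "a < k" for a
      using less[OF that] by (simp add: digit_def)
    then have "(\<lambda>a\<in>{..<k}. js a div ?q) \<in> ?NC"
      using nc[of m] less by auto
    ultimately show ?thesis by simp
  qed
  then have "?h ` nonconst_tuples k (Suc m) n \<subseteq> nonconst_tuples k m n \<times> ?NC"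
    by (rule image_subsetI)
  from card_inj_on_le[OF inj this finite_cartesian_product[OF fin]]
  have "card (nonconst_tuples k (Suc m) n) \<le> card (nonconst_tuples k m n \<times> ?NC)" .
  also have "\<dots> \<le> (n ^ k * (5 ^ k - 5) ^ m) * (5 ^ k - 5)"
    unfolding card_cartesian_product using Suc card_nonconst[OF assms(1), of 5] by (rule mult_le_mono)
  finally show ?case by (simp add: mult_ac)
qed

text \<open>Here \<open>pi / 5\<close> is half the length of one of five equal arcs. The rational
  bound \<open>0.792\<close> for the cosine has square just above the threshold \<open>5/8\<close>
  of \<open>odd_fun_peaking\<close>.\<close>

lemma cos_sq_ge_small_arc:
  assumes "\<bar>x\<bar> \<le> pi / 5"
  shows "0 < cos x \<and> 5/8 \<le> (cos x)^2"
proof -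
  have "\<bar>x\<bar> \<le> 16/25" using assms pi_approx by (simp add: abs_if split: if_splits)
  then have "\<bar>sin (x/2)\<bar> \<le> 8/25" using abs_sin_x_le_abs_x[of "x/2"] by simp
  then have "(sin (x/2))^2 \<le> (8/25)^2" by (metis abs_le_square_iff abs_numeral abs_divide)
  moreover have "cos x = 1 - 2 * (sin (x/2))^2" using cos_double_sin[of "x/2"] by simp
  ultimately have c: "4/5 - 1/125 \<le> cos x" by (simp add: power2_eq_square)
  have "(4/5 - 1/125)^2 \<le> (cos x)^2" using c by (intro power_mono) auto
  then show ?thesis using c by (simp add: power2_eq_square)
qed

section \<open>The number of distinct frequencies\<close>

definition freqs :: "nat \<Rightarrow> nat \<Rightarrow> nat set" where
  "freqs k m = (\<lambda>(i, r). 5 ^ i * (2 * r + 1)) ` ({..m} \<times> {..<3 * k})"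

lemma finite_freqs: "finite (freqs k m)" by (simp add: freqs_def)

text \<open>Since \<open>2 * r + 1\<close> is divisible by five exactly when
  \<open>r mod 5 = 2\<close>, this counts the multiples of five among the first \<open>x\<close> odd
  numbers.\<close>

lemma card_mod_five: "card {r. r < x \<and> r mod 5 = (2::nat)} = (x + 2) div 5"
proof (induction x)
  case (Suc x)
  have "{r. r < Suc x \<and> r mod 5 = 2} = (if x mod 5 = 2 then insert x {r. r < x \<and> r mod 5 = 2} else {r. r < x \<and> r mod 5 = 2})"
    by (auto simp: less_Suc_eq)
  moreover have "(Suc x + 2) div 5 = (x + 2) div 5 + (if x mod 5 = 2 then 1 else 0)"
    by (simp split: if_splits) presburger
  ultimately show ?case using Suc by simp
qed simp

text \<open>Passing to \<open>Suc m\<close> joins a block of \<open>3 * k\<close> odd numbers to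
  five times the old frequencies; the overlap is the multiples of five in the block. The additive
  form avoids truncated subtraction.\<close>

lemma card_freqs: "card (freqs k m) + m * ((3 * k + 2) div 5) = 3 * k * (m + 1)"
proof (induction m)
  case 0
  have "freqs k 0 = (\<lambda>r. 2 * r + 1) ` {..<3 * k}" by (force simp: freqs_def)
  then show ?case by (simp add: card_image inj_on_def)
next
  case (Suc m)
  let ?O = "(\<lambda>r::nat. 2 * r + 1) ` {..<3 * k}"
  have eq: "freqs k (Suc m) = ?O \<union> (*) 5 ` freqs k m"
  proof
    show "freqs k (Suc m) \<subseteq> ?O \<union> (*) 5 ` freqs k m"
    proof
      fix w assume "w \<in> freqs k (Suc m)"
      then obtain i r where w: "w = 5 ^ i * (2 * r + 1)" "i \<le> Suc m" "r < 3 * k" by (auto simp: freqs_def)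
      show "w \<in> ?O \<union> (*) 5 ` freqs k m"
      proof (cases i)
        case 0
        then show ?thesis using w by auto
      next
        case (Suc i')
        then have "w = 5 * (5 ^ i' * (2 * r + 1))" "5 ^ i' * (2 * r + 1) \<in> freqs k m"
          using w by (auto simp: freqs_def)
        then show ?thesis by blast
      qed
    qed
    have "?O \<subseteq> freqs k (Suc m)" by (force simp: freqs_def)
    moreover have "5 * w \<in> freqs k (Suc m)" if w: "w \<in> freqs k m" for w
    proof -
      obtain i r where "w = 5 ^ i * (2 * r + 1)" "i \<le> m" "r < 3 * k" using w by (auto simp: freqs_def)
      then have "5 * w = 5 ^ Suc i * (2 * r + 1)" "Suc i \<le> Suc m" by simp_all
      then show ?thesis using \<open>r < 3 * k\<close> unfolding freqs_def
        by (intro image_eqI[of _ _ "(Suc i, r)"]) auto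
    qed
    ultimately show "?O \<union> (*) 5 ` freqs k m \<subseteq> freqs k (Suc m)" by blast
  qed
  have int: "?O \<inter> (*) 5 ` freqs k m = (\<lambda>r. 2 * r + 1) ` {r. r < 3 * k \<and> r mod 5 = 2}"
  proof
    show "?O \<inter> (*) 5 ` freqs k m \<subseteq> (\<lambda>r. 2 * r + 1) ` {r. r < 3 * k \<and> r mod 5 = 2}"
    proof
      fix w assume "w \<in> ?O \<inter> (*) 5 ` freqs k m"
      then obtain r v where "r < 3 * k" "w = 2 * r + 1" "w = 5 * v" by (elim IntE imageE) simp
      moreover then have "r mod 5 = 2" by presburger
      ultimately show "w \<in> (\<lambda>r. 2 * r + 1) ` {r. r < 3 * k \<and> r mod 5 = 2}" by blast
    qed
    show "(\<lambda>r. 2 * r + 1) ` {r. r < 3 * k \<and> r mod 5 = 2} \<subseteq> ?O \<inter> (*) 5 ` freqs k m"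
    proof
      fix w :: nat assume "w \<in> (\<lambda>r. 2 * r + 1) ` {r. r < 3 * k \<and> r mod 5 = 2}"
      then obtain r where r: "w = 2 * r + 1" "r < 3 * k" "r mod 5 = 2" by auto
      \<comment> \<open>Dividing \<open>w\<close> by five gives the odd number
        \<open>2 * s + 1\<close>, again in the unscaled block, so the overlap does not depend on
        \<open>m\<close>.\<close>
      define s where "s = r div 5"
      have "r = 5 * s + 2" using r(3) by (simp add: s_def) presburger
      then have "w = 5 * (5 ^ 0 * (2 * s + 1))" "s < 3 * k" using r by simp_all
      moreover then have "5 ^ 0 * (2 * s + 1) \<in> freqs k m" unfolding freqs_def
        by (intro image_eqI[of _ _ "(0, s)"]) auto
      ultimately show "w \<in> ?O \<inter> (*) 5 ` freqs k m" using r by blast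
    qed
  qed
  have "card ?O + card ((*) 5 ` freqs k m) = card (freqs k (Suc m)) + card (?O \<inter> (*) 5 ` freqs k m)"
    unfolding eq by (rule card_Un_Int) (auto simp: finite_freqs)
  moreover have "card ?O = 3 * k" by (simp add: card_image inj_on_def)
  moreover have "card ((*) 5 ` freqs k m) = card (freqs k m)" by (simp add: card_image inj_on_def)
  moreover have "card (?O \<inter> (*) 5 ` freqs k m) = (3 * k + 2) div 5"
    unfolding int by (subst card_image) (auto simp: inj_on_def card_mod_five)
  ultimately show ?case using Suc by simp
qed

lemma freqs_pos: "w \<in> freqs k m \<Longrightarrow> 0 < w"
  by (auto simp: freqs_def)

lemma freqs_le:
  assumes "w \<in> freqs k m"
  shows "w \<le> (6 * k - 1) * 5 ^ m"
proof -
  obtain i r where w: "w = 5 ^ i * (2 * r + 1)" "i \<le> m" "r < 3 * k" using assms by (auto simp: freqs_def)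
  have "2 * r + 1 \<le> 6 * k - 1" using w(3) by linarith
  moreover have "(5::nat) ^ i \<le> 5 ^ m" using w(2) by (simp add: power_increasing)
  ultimately show ?thesis unfolding w(1) mult.commute[of "5 ^ i"] by (intro mult_le_mono)
qed

lemma freq_in_freqs:
  assumes "i < 6 * k * (m + 1)"
  shows "freq k i \<in> freqs k m"
proof -
  have k: "k > 0" using assms by (cases k) auto
  have "i div (6 * k) < m + 1" using assms by (simp add: less_mult_imp_div_less mult.commute)
  moreover have "i mod (6 * k) < 2 * (3 * k)" using k by simp
  then have "i mod (6 * k) div 2 < 3 * k" by linarith
  ultimately show ?thesis unfolding freqs_def freq_def by (intro image_eqI[of _ _ "(i div (6 * k), i mod (6 * k) div 2)"]) auto
qed

lemma freq_attained:
  assumes "w \<in> freqs k m"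
  shows "\<exists>i < 6 * k * (m + 1). freq k i = w \<and> even i = b"
proof -
  obtain i r where w: "w = 5 ^ i * (2 * r + 1)" "i \<le> m" "r < 3 * k" using assms by (auto simp: freqs_def)
  define e where "e = (if b then 0 else 1 :: nat)"
  have "6 * k * i + 2 * r + e < 6 * k * m + 6 * k"
  proof -
    have "6 * k * i \<le> 6 * k * m" using w(2) by simp
    moreover have "2 * r + e < 6 * k" using w(3) by (simp add: e_def)
    ultimately show ?thesis by linarith
  qed
  moreover have "freq k (6 * k * i + 2 * r + e) = w"
    using freq_index[OF w(3), of e i] w(1) by (auto simp: e_def)
  moreover have "even (6 * k * i + 2 * r + e) = b" by (simp add: e_def)
  ultimately show ?thesis by (intro exI[of _ "6 * k * i + 2 * r + e"]) (simp add: algebra_simps)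
qed

section \<open>Dimension, vertices and faces\<close>

context curve_polytope
begin

section \<open>Discrete orthogonality and the span of the vertices\<close>

lemma sum_cis_pt:
  assumes "\<bar>w\<bar> < int N"
  shows "(\<Sum>j<N. cis (of_int w * pt j)) = (if w = 0 then of_nat N else 0)"
proof (cases "w = 0")
  case False
  define x where "x = cis (of_int w * (2 * pi / real N))"
  have pow: "cis (of_int w * pt j) = x ^ j" for j
    unfolding x_def Complex.DeMoivre pt_def by (rule arg_cong[of _ _ cis]) simp
  have "x \<noteq> 1"
  proof
    assume "x = 1"
    then have "cos (of_int w * (2 * pi / real N)) = 1" by (simp add: x_def complex_eq_iff)
    then obtain z :: int where "of_int w * (2 * pi / real N) = of_int z * 2 * pi"
      by (auto simp: cos_one_2pi_int)
    then have "2 * pi * of_int w = 2 * pi * (of_int z * real N)"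
      using N_pos by (simp add: field_simps)
    then have "real_of_int w = of_int (z * int N)" by simp
    then have "w = z * int N" by (simp only: of_int_eq_iff)
    then have "int N dvd w" by simp
    then show False using assms False dvd_imp_le_int[of w "int N"] by simp
  qed
  moreover have "x ^ N = cis (2 * pi * of_int w)"
    unfolding x_def Complex.DeMoivre using N_pos by (intro arg_cong[of _ _ cis]) simp
  then have "x ^ N = 1" by (simp add: cis_multiple_2pi)
  ultimately show ?thesis using False by (simp add: pow geometric_sum)
qed simp

lemma sum_cos_pt: "\<bar>w\<bar> < int N \<Longrightarrow> (\<Sum>j<N. cos (of_int w * pt j)) = (if w = 0 then real N else 0)"
  and sum_sin_pt: "\<bar>w\<bar> < int N \<Longrightarrow> (\<Sum>j<N. sin (of_int w * pt j)) = 0"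
  using arg_cong[OF sum_cis_pt, of w Re] arg_cong[OF sum_cis_pt, of w Im] by auto

text \<open>Product-to-sum leads to the frequencies \<open>v - w\<close> and \<open>v + w\<close>;
  both are below \<open>N\<close> in absolute value, and only the difference can vanish.\<close>

lemma orthogonality:
  assumes "0 < v" "0 < w" "v + w < N"
  shows "(\<Sum>j<N. cos (real v * pt j) * cos (real w * pt j)) = (if v = w then real N / 2 else 0)"
    and "(\<Sum>j<N. sin (real v * pt j) * sin (real w * pt j)) = (if v = w then real N / 2 else 0)"
    and "(\<Sum>j<N. sin (real v * pt j) * cos (real w * pt j)) = 0"
proof -
  have *: "\<bar>int v - int w\<bar> < int N" "\<bar>int v + int w\<bar> < int N" using assms by auto
  note c = sum_cos_pt[OF *(1)] sum_cos_pt[OF *(2)] sum_sin_pt[OF *(1)] sum_sin_pt[OF *(2)]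
  show "(\<Sum>j<N. cos (real v * pt j) * cos (real w * pt j)) = (if v = w then real N / 2 else 0)"
    using c assms by (simp add: cos_times_cos sum_divide_distrib[symmetric] sum.distrib algebra_simps)
  show "(\<Sum>j<N. sin (real v * pt j) * sin (real w * pt j)) = (if v = w then real N / 2 else 0)"
    using c assms by (simp add: sin_times_sin sum_divide_distrib[symmetric] sum_subtractf algebra_simps)
  show "(\<Sum>j<N. sin (real v * pt j) * cos (real w * pt j)) = 0"
    unfolding sin_times_cos using c assms by (simp add: sum_divide_distrib[symmetric] sum.distrib algebra_simps)
qed

lemma PsiVec_nth: "PsiVec k m beta t $ i =
    (if even (beta i) then cos (real (freq k (beta i)) * t) else sin (real (freq k (beta i)) * t))"
  by (simp add: PsiVec_def Psi_eq[OF beta_less])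

text \<open>Blocks share frequencies, so one harmonic may occupy several coordinates; this vector
  marks all of them, for the cosine if \<open>b\<close> is true and for the sine otherwise.\<close>

definition ev :: "nat \<Rightarrow> bool \<Rightarrow> real ^ 'n" where
  "ev w b = (\<chi> i. if freq k (beta i) = w \<and> even (beta i) = b then 1 else 0)"

definition harmonics :: "(real ^ 'n) set" where
  "harmonics = (\<lambda>(w, b). ev w b) ` (freqs k m \<times> UNIV)"

lemma ev_attained:
  assumes "w \<in> freqs k m"
  shows "\<exists>i. freq k (beta i) = w \<and> even (beta i) = b"
proof -
  obtain i where "i < 6 * k * (m + 1)" "freq k i = w" "even i = b"
    using freq_attained[OF assms] by blast
  then show ?thesis using beta_ex[of i] by blast
qed

lemma inj_ev: "inj_on (\<lambda>(w, b). ev w b) (freqs k m \<times> UNIV)"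
proof (rule inj_onI, clarsimp)
  fix w b v c assume w: "w \<in> freqs k m" and eq: "ev w b = ev v c"
  obtain i where i: "freq k (beta i) = w" "even (beta i) = b" using ev_attained[OF w] by blast
  have "ev v c $ i = 1" using i eq[symmetric] by (simp add: ev_def)
  then show "w = v \<and> b = c" using i by (simp add: ev_def split: if_splits)
qed

lemma card_harmonics: "card harmonics = 2 * card (freqs k m)"
  unfolding harmonics_def by (simp add: card_image[OF inj_ev] card_cartesian_product)

text \<open>Distinct harmonics have disjoint supports, hence are orthogonal; none is zero because
  every frequency occurs both as a cosine and as a sine.\<close>

lemma independent_harmonics: "independent harmonics"
proof (rule pairwise_orthogonal_independent)
  have ind: "P" if "(if P then 1 else 0 :: real) \<noteq> 0" for P using that by (cases P) auto
  have nz: "freq k (beta i) = w \<and> even (beta i) = b" if "ev w b $ i \<noteq> 0" for w b i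
    using ind that[unfolded ev_def vec_lambda_beta] by blast
  have orth: "ev w b \<bullet> ev v c = 0" if ne: "(w, b) \<noteq> (v, c)" for w b v c
  proof -
    have "ev w b $ i * ev v c $ i = 0" for i
    proof (rule ccontr)
      assume "ev w b $ i * ev v c $ i \<noteq> 0"
      then have "ev w b $ i \<noteq> 0" "ev v c $ i \<noteq> 0" by simp_all
      from nz[OF this(1)] nz[OF this(2)] have "w = v" "b = c" by blast+
      then show False using ne by blast
    qed
    then show ?thesis by (simp only: inner_vec_def inner_real_def sum.neutral_const)
  qed
  show "pairwise orthogonal harmonics"
  proof (rule pairwiseI)
    fix x y assume xy: "x \<in> harmonics" "y \<in> harmonics" "x \<noteq> y"
    obtain w b where x: "x = ev w b" using xy(1) unfolding harmonics_def by auto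
    obtain v c where y: "y = ev v c" using xy(2) unfolding harmonics_def by auto
    show "orthogonal x y"
      unfolding orthogonal_def x y by (rule orth) (use xy(3) x y in blast)
  qed
  show "0 \<notin> harmonics"
  proof
    assume "0 \<in> harmonics"
    then obtain w b where w: "w \<in> freqs k m" "ev w b = 0" by (auto simp: harmonics_def)
    obtain i where "freq k (beta i) = w" "even (beta i) = b" using ev_attained[OF w(1)] by blast
    then have "ev w b $ i = 1" unfolding ev_def vec_lambda_beta by (intro if_P conjI)
    then show False using w(2) by simp
  qed
qed

lemma vert_in_span_harmonics: "PsiVec k m beta t \<in> span harmonics"
proof -
  have "PsiVec k m beta t =
      (\<Sum>w\<in>freqs k m. cos (real w * t) *\<^sub>R ev w True + sin (real w * t) *\<^sub>R ev w False)" (is "_ = ?R")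
  proof (rule vec_eq_iff[THEN iffD2], rule allI)
    fix i
    have "?R $ i = (\<Sum>w\<in>freqs k m. if w = freq k (beta i) then PsiVec k m beta t $ i else 0)"
      unfolding sum_component by (intro sum.cong) (auto simp: ev_def PsiVec_nth)
    also have "\<dots> = PsiVec k m beta t $ i"
      using freq_in_freqs[OF beta_less] by (simp add: finite_freqs)
    finally show "PsiVec k m beta t $ i = ?R $ i" by simp
  qed
  moreover have "ev w b \<in> span harmonics" if "w \<in> freqs k m" for w b
    using that by (intro span_base) (auto simp: harmonics_def)
  ultimately show ?thesis by (simp add: span_sum span_add span_scale)
qed

text \<open>Discrete Fourier inversion: summing the vertices against one sampled harmonic isolates
  its indicator vector, with factor \<open>N / 2\<close>.\<close>

lemma harmonics_in_span_vert:
  assumes "n > 2 * (6 * k - 1)"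
  shows "harmonics \<subseteq> span (vert ` {..<N})"
proof
  fix x assume "x \<in> harmonics"
  then obtain w b where w: "w \<in> freqs k m" "x = ev w b" by (auto simp: harmonics_def)
  \<comment> \<open>This is where the bound on \<open>n\<close> enters: sums of two frequencies stay
    below \<open>N\<close>, so distinct harmonics do not alias on the sample points.\<close>
  have less: "w + v < N" if "v \<in> freqs k m" for v
  proof -
    have "w + v \<le> (2 * (6 * k - 1)) * 5 ^ m" using freqs_le[OF w(1)] freqs_le[OF that] by simp
    also have "\<dots> < N" using assms by (simp add: N_def)
    finally show ?thesis .
  qed
  define g where "g j = (if b then cos (real w * pt j) else sin (real w * pt j))" for j
  have "(\<Sum>j<N. g j *\<^sub>R vert j) = (real N / 2) *\<^sub>R ev w b"
  proof (rule vec_eq_iff[THEN iffD2], rule allI)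
    fix i
    let ?v = "freq k (beta i)"
    have v: "?v \<in> freqs k m" using freq_in_freqs[OF beta_less] .
    note o = orthogonality[OF freqs_pos[OF w(1)] freqs_pos[OF v] less[OF v]]
      orthogonality(3)[OF freqs_pos[OF v] freqs_pos[OF w(1)]]
    show "(\<Sum>j<N. g j *\<^sub>R vert j) $ i = ((real N / 2) *\<^sub>R ev w b) $ i"
      using o less[OF v] by (cases b; cases "even (beta i)") (auto simp: PsiVec_nth g_def ev_def mult.commute)
  qed
  then have "ev w b = (2 / real N) *\<^sub>R (\<Sum>j<N. g j *\<^sub>R vert j)" using N_pos by simp
  moreover have "(2 / real N) *\<^sub>R (\<Sum>j<N. g j *\<^sub>R vert j) \<in> span (vert ` {..<N})"
    by (intro span_scale span_sum span_base) auto
  ultimately show "x \<in> span (vert ` {..<N})" using w(2) by simp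
qed

section \<open>Central symmetry and the dimension\<close>

lemma vert_half: "vert (j + N div 2) = - vert j"
proof -
  have odd_freq: "odd (freq k i)" for i by (simp add: freq_def)
  have "cos (real w * (t + pi)) = - cos (real w * t) \<and> sin (real w * (t + pi)) = - sin (real w * t)"
    if "odd w" for w t
    using that by (simp add: distrib_left cos_add sin_add)
  then show ?thesis using odd_freq by (simp add: vec_eq_iff PsiVec_nth pt_half)
qed

lemma vert_cong:
  assumes "[x = y] (mod N)"
  shows "vert x = vert y"
proof -
  have "cos (real w * pt x - c) = cos (real w * pt y - c)" for w c
    using trig_pt_cong[OF trig.cos[of w w 1 c] assms] by simp
  from this[of _ 0] this[of _ "pi/2"] show ?thesis
    by (simp add: vec_eq_iff PsiVec_nth cos_diff)
qed

lemma uminus_verts: "uminus ` vert ` {..<N} = vert ` {..<N}"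
proof -
  have sub: "uminus ` vert ` {..<N} \<subseteq> vert ` {..<N}"
  proof (safe)
    fix j
    have "- vert j = vert ((j + N div 2) mod N)"
      using vert_half vert_cong[of "(j + N div 2) mod N" "j + N div 2"] by (simp add: cong_def)
    then show "- vert j \<in> vert ` {..<N}" using N_pos by auto
  qed
  then have "uminus ` uminus ` vert ` {..<N} \<subseteq> uminus ` vert ` {..<N}" by (rule image_mono)
  then show ?thesis using sub by (simp add: image_image)
qed

lemma uminus_Ptope: "uminus ` Ptope k m n beta = Ptope k m n beta"
proof -
  have "linear (uminus :: real ^ 'n \<Rightarrow> _)" by (rule linear_uminus)
  then have "uminus ` (convex hull (vert ` {..<N})) = convex hull (uminus ` vert ` {..<N})"
    by (rule convex_hull_linear_image)
  then show ?thesis by (simp only: Ptope_eq uminus_verts)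
qed

text \<open>By symmetry the origin is the midpoint of two opposite vertices, so affine and linear
  dimension agree.\<close>

lemma aff_dim_Ptope: "aff_dim (Ptope k m n beta) = int (dim (vert ` {..<N}))"
proof -
  have v: "vert 0 \<in> vert ` {..<N}" using N_pos by auto
  then have "- vert 0 \<in> vert ` {..<N}" using uminus_verts by (metis imageI)
  with v have "(1/2) *\<^sub>R vert 0 + (1/2) *\<^sub>R (- vert 0) \<in> affine hull (vert ` {..<N})"
    by (intro mem_affine[OF affine_affine_hull]) (auto intro: hull_inc)
  then show ?thesis unfolding Ptope_eq aff_dim_convex_hull by (intro aff_dim_zero) simp
qed

lemma aff_dim_le: "aff_dim (Ptope k m n beta) \<le> int (2 * card (freqs k m))"
proof -
  have "dim (vert ` {..<N}) \<le> card harmonics"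
    using vert_in_span_harmonics
    by (intro dim_le_card) (auto simp: harmonics_def finite_freqs)
  then show ?thesis by (simp add: aff_dim_Ptope card_harmonics)
qed

lemma aff_dim_eq:
  assumes "n > 2 * (6 * k - 1)"
  shows "aff_dim (Ptope k m n beta) = int (2 * card (freqs k m))"
proof -
  have "card harmonics \<le> dim (vert ` {..<N})"
    using independent_card_le_dim[OF harmonics_in_span_vert[OF assms] independent_harmonics] by simp
  then show ?thesis using aff_dim_le by (simp add: aff_dim_Ptope card_harmonics)
qed

section \<open>Vertices\<close>

lemma cos_pt_eq_1:
  assumes "j < N" "j' < N" "cos (pt j' - pt j) = 1"
  shows "j' = j"
proof -
  obtain z :: int where "pt j' - pt j = 2 * pi * of_int z"
    using assms(3) by (auto simp: cos_one_2pi_int)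
  from cong_of_pt_diff[OF this] show ?thesis
    using assms cong_less_modulus_unique_nat by blast
qed

lemma inj_pt: "inj_on pt {..<N}"
  by (intro inj_onI) (auto intro: cos_pt_eq_1)

lemma trig_cos_shift: "trig (6 * k - 1) (\<lambda>t. cos (t - b))"
  using trig.cos[of 1 "6 * k - 1" 1 b] k by simp

lemma inj_vert: "inj_on vert {..<N}"
proof (rule inj_onI)
  fix j j' assume j: "j \<in> {..<N}" "j' \<in> {..<N}" "vert j = vert j'"
  obtain v where "\<forall>t. v \<bullet> PsiVec k m beta t = cos (5 ^ 0 * t - pt j)"
    using functional_of_trig[OF trig_cos_shift refl le0] by blast
  then have "cos (pt j' - pt j) = cos (pt j - pt j)" using j(3) by (metis mult_1 power_0)
  then show "j = j'" using cos_pt_eq_1[of j j'] j by simp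
qed

text \<open>The functional realising \<open>cos (t - pt j)\<close> attains its maximum
  \<open>1\<close> only at index \<open>j\<close>, so it cuts out that vertex as a face.\<close>

lemma extreme_points_Ptope: "{v. v extreme_point_of Ptope k m n beta} = vert ` {..<N}"
proof -
  have "vert j extreme_point_of convex hull (vert ` {..<N})" if j: "j < N" for j
  proof -
    have "convex hull (vert ` {j' \<in> {..<N}. cos (pt (5 ^ 0 * j') - pt j) = 1}) face_of
        convex hull (vert ` {..<N})"
      by (intro face_restrict trig_cos_shift) auto
    moreover have "{j' \<in> {..<N}. cos (pt (5 ^ 0 * j') - pt j) = 1} = {j}"
      using cos_pt_eq_1[OF j] j by auto
    ultimately show ?thesis by (simp add: face_of_singleton)
  qed
  then show ?thesis unfolding Ptope_eq using extreme_point_of_convex_hull by blast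
qed

section \<open>Faces from equal digits, and the number of bad tuples\<close>

lemma digit_arc:
  assumes "i + Suc l = m" "digit n l j = d"
  shows "\<bar>pt (5 ^ i * (j mod (n * 5 ^ Suc l))) - (2 * pi * real d / 5 + pi / 5)\<bar> \<le> pi / 5"
proof -
  let ?q = "n * 5 ^ l"
  define s where "s = j mod ?q"
  have q: "?q > 0" using n by simp
  have s: "s < ?q" unfolding s_def using q by (rule mod_less_divisor)
  \<comment> \<open>After this reduction \<open>d\<close> is the leading digit, so the scaled angle
    lies in an arc of length \<open>2 * pi / 5\<close> starting at
    \<open>2 * pi * d / 5\<close>.\<close>
  have "j mod (?q * 5) = ?q * d + s"
    using assms(2) by (simp only: mod_mult2_eq digit_def s_def)
  then have r: "real (j mod (n * 5 ^ Suc l)) = real ?q * real d + real s" by (simp add: mult_ac flip: of_nat_mult of_nat_add)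
  have "5 ^ m = (5 ^ i * 5 ^ Suc l :: nat)" by (simp only: assms(1)[symmetric] power_add)
  then have N: "real N = 5 ^ i * (5 * real ?q)" by (simp add: N_def)
  have "pt (5 ^ i * (j mod (n * 5 ^ Suc l))) = 2 * pi * (real ?q * real d + real s) / (5 * real ?q)"
    unfolding pt_def N of_nat_mult r by simp
  also have "\<dots> = 2 * pi * real d / 5 + 2 * pi / 5 * (real s / real ?q)"
    using q by (simp add: field_simps)
  finally have e: "pt (5 ^ i * (j mod (n * 5 ^ Suc l))) - (2 * pi * real d / 5 + pi / 5)
      = pi / 5 * (2 * (real s / real ?q) - 1)" by (simp add: algebra_simps)
  have "0 \<le> real s / real ?q" "real s / real ?q \<le> 1"
    using s q by (simp_all only: divide_le_eq_1 of_nat_0_less_iff of_nat_le_iff) auto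
  then have "\<bar>2 * (real s / real ?q) - 1\<bar> \<le> 1" by linarith
  then show ?thesis unfolding e abs_mult by (simp add: mult_left_le)
qed

text \<open>Multiplying by \<open>5 ^ i\<close> with \<open>i + Suc l = m\<close> erases modulo
  \<open>N\<close> all digits above place \<open>l\<close>, so digit \<open>l\<close> alone decides
  which of the five arcs is hit.\<close>

lemma face_of_equal_digit:
  assumes T: "T \<subseteq> {..<N}" "T \<noteq> {}" "card T \<le> k" and l: "l < m"
    and d: "\<And>t. t \<in> T \<Longrightarrow> digit n l t = d"
  shows "convex hull (vert ` T) face_of Ptope k m n beta"
proof -
  define i where "i = m - Suc l"
  have i: "i + Suc l = m" using l by (simp add: i_def)
  show ?thesis
    unfolding Ptope_eq
  proof (rule face_of_arc[OF T, of i "2 * pi * real d / 5 + pi / 5"])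
    fix t assume t: "t \<in> T"
    have "5 ^ m = (5 ^ i * 5 ^ Suc l :: nat)" by (simp only: i[symmetric] power_add)
    then have "N = 5 ^ i * (n * 5 ^ Suc l)" by (simp add: N_def)
    then have "[5 ^ i * t = 5 ^ i * (t mod (n * 5 ^ Suc l))] (mod N)"
      by (simp only: cong_def mult_mod_right[symmetric] mod_mod_trivial)
    from cos_pt_cong[OF this] cos_sq_ge_small_arc[OF digit_arc[OF i d[OF t]]]
    show "0 < cos (pt (5 ^ i * t) - (2 * pi * real d / 5 + pi / 5)) \<and>
        5 / 8 \<le> (cos (pt (5 ^ i * t) - (2 * pi * real d / 5 + pi / 5)))\<^sup>2" by simp
  qed (use i in simp)
qed

lemma polytope_Ptope: "polytope (Ptope k m n beta)"
  unfolding Ptope_eq by (intro polytope_convex_hull) simp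

text \<open>A tuple with a constant digit place spans a face, and faces of a polytope are exposed.
  So bad tuples come from \<open>nonconst_tuples\<close>, with \<open>pt\<close> inverted to pass
  from angles to indices.\<close>

lemma card_nonfaces:
  "card {ts \<in> {..<k} \<rightarrow>\<^sub>E A m n.
      \<not> (convex hull (PsiVec k m beta ` ts ` {..<k})) exposed_face_of Ptope k m n beta}
    \<le> n ^ k * (5 ^ k - 5) ^ m" (is "card ?F \<le> _")
proof -
  let ?g = "\<lambda>js. \<lambda>a\<in>{..<k}. pt (js a)"
  have "?F \<subseteq> ?g ` nonconst_tuples k m n"
  proof
    fix ts assume ts: "ts \<in> ?F"
    define js where "js = (\<lambda>a\<in>{..<k}. inv_into {..<N} pt (ts a))"
    have mem: "ts a \<in> pt ` {..<N}" if "a < k" for a using ts that A_eq by (auto simp: PiE_def Pi_def)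
    then have js: "js a < N" "pt (js a) = ts a" if "a < k" for a
      using that inv_into_into[of "ts a" pt "{..<N}"] by (auto simp: js_def f_inv_into_f)
    have tseq: "ts = ?g js"
      using ts js(2) by (auto simp: fun_eq_iff PiE_def extensional_def)
    have "\<not> (\<exists>d. \<forall>a<k. digit n l (js a) = d)" if "l < m" for l
    proof
      assume "\<exists>d. \<forall>a<k. digit n l (js a) = d"
      then obtain d where d: "\<forall>a<k. digit n l (js a) = d" by blast
      \<comment> \<open>Coinciding entries only make the set of indices smaller.\<close>
      have "card (js ` {..<k}) \<le> k" using card_image_le[of "{..<k}" js] by simp
      then have "convex hull (vert ` js ` {..<k}) face_of Ptope k m n beta"
        using js(1) k d by (intro face_of_equal_digit[of _ l d] that) (auto simp: lessThan_empty_iff)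
      moreover have "vert ` js ` {..<k} = PsiVec k m beta ` ts ` {..<k}"
        using js(2) by (auto simp: image_image)
      ultimately show False
        using ts exposed_face_of_polyhedron[OF polytope_imp_polyhedron[OF polytope_Ptope]] by simp
    qed
    moreover have "js \<in> {..<k} \<rightarrow>\<^sub>E {..<N}" using js(1) by (auto simp: js_def)
    ultimately have "js \<in> nonconst_tuples k m n" by (simp add: nonconst_tuples_def N_def)
    then show "ts \<in> ?g ` nonconst_tuples k m n" using tseq by blast
  qed
  moreover have fin: "finite (nonconst_tuples k m n)"
    unfolding nonconst_tuples_def by (simp add: finite_PiE)
  ultimately have "card ?F \<le> card (nonconst_tuples k m n)" by (rule surj_card_le[rotated])
  also have "\<dots> \<le> n ^ k * (5 ^ k - 5) ^ m" by (rule card_nonconst_tuples[OF k n(1)])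
  finally show ?thesis .
qed

end

theorem theorem1p3:
  fixes k m n :: nat and beta :: "'n::finite \<Rightarrow> nat"
  assumes "k \<ge> 1" and "n > 0" and "even n"
    and "CARD('n) = 6 * k * (m + 1)"
    and "bij_betw beta UNIV {..<6 * k * (m + 1)}"
  shows "polytope (Ptope k m n beta)
    \<and> uminus ` Ptope k m n beta = Ptope k m n beta
    \<and> {v. v extreme_point_of Ptope k m n beta} = PsiVec k m beta ` A m n
    \<and> card (PsiVec k m beta ` A m n) = n * 5 ^ m
    \<and> aff_dim (Ptope k m n beta) \<le> int (6 * k * (m + 1)) - 2 * int m * ((3 * int k + 2) div 5)
    \<and> (n > 2 * (6 * k - 1) \<longrightarrow>
         aff_dim (Ptope k m n beta) = int (6 * k * (m + 1)) - 2 * int m * ((3 * int k + 2) div 5))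
    \<and> real (card {ts \<in> {..<k} \<rightarrow>\<^sub>E A m n.
          \<not> (convex hull (PsiVec k m beta ` ts ` {..<k})) exposed_face_of Ptope k m n beta})
        / real (card (A m n)) ^ k
      \<le> (1 - 1 / 5 ^ (k - 1)) ^ m"
proof -
  interpret curve_polytope k m n beta using assms by unfold_locales
  have V: "PsiVec k m beta ` A m n = vert ` {..<N}" by (simp add: A_eq image_image)
  have "int (card (freqs k m)) + int m * ((3 * int k + 2) div 5) = 3 * int k * (int m + 1)"
    using arg_cong[OF card_freqs[of k m], of int] by (simp add: zdiv_int algebra_simps)
  then have dim: "int (2 * card (freqs k m)) =
      int (6 * k * (m + 1)) - 2 * int m * ((3 * int k + 2) div 5)"
    by (simp add: algebra_simps)
  let ?F = "{ts \<in> {..<k} \<rightarrow>\<^sub>E A m n.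
          \<not> (convex hull (PsiVec k m beta ` ts ` {..<k})) exposed_face_of Ptope k m n beta}"
  have cA: "card (A m n) = n * 5 ^ m"
    using card_image[OF inj_pt] by (simp add: A_eq) (simp add: N_def)
  \<comment> \<open>Ensures that the truncated difference \<open>5 ^ k - 5\<close> on naturals
    agrees with the real one.\<close>
  have le5: "(5::nat) \<le> 5 ^ k" using power_increasing[of 1 k "5::nat"] assms(1) by simp
  have "real (card ?F) \<le> real (n ^ k * (5 ^ k - 5) ^ m)"
    using card_nonfaces by (simp only: of_nat_le_iff)
  also have "\<dots> = real n ^ k * (5 ^ k - 5) ^ m" using le5 by (simp add: of_nat_diff)
  finally have "real (card ?F) / real (card (A m n)) ^ k \<le> real n ^ k * (5 ^ k - 5) ^ m / real (card (A m n)) ^ k"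
    by (rule divide_right_mono) simp
  also have "\<dots> = ((5 ^ k - 5) / 5 ^ k) ^ m"
    using assms(2) by (simp add: cA power_mult_distrib power_divide power_mult[symmetric] mult.commute)
  also have "(5 ^ k - 5) / 5 ^ k = (1 - 1 / 5 ^ (k - 1) :: real)"
    using assms(1) by (cases k) (auto simp: field_simps)
  finally have prob: "real (card ?F) / real (card (A m n)) ^ k \<le> (1 - 1 / 5 ^ (k - 1)) ^ m" .
  show ?thesis
    using polytope_Ptope uminus_Ptope extreme_points_Ptope aff_dim_le aff_dim_eq prob
      card_image[OF inj_vert]
    unfolding V dim by (simp add: N_def)
qed

end
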